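(* Let $G$ be a path-connected group-like space or a path-connected CW $H$-space, let $m\ge2$, and let $f_i\colon X\to G$ be maps for $1\le i\le m$. Let $F_m\colon G^m\to G^{m-1}$ be the map $F_m(x_1,\dots,x_m)=(F(x_1,x_2),F(x_2,x_3),\dots,F(x_{m-1},x_m))$, where $F\colon G\times G\to G$ is the difference map specified in the context, and let $(f_1,\dots,f_m)\colon X\to G^m$ be $x\mapsto(f_1(x),\dots,f_m(x))$. Then $$\mathsf{D}(f_1,\dots,f_m)=\mathsf{cat}(F_m\circ(f_1,\dots,f_m))\quad\text{and}\quad\mathsf{dD}(f_1,\dots,f_m)=\mathsf{dcat}(F_m\circ(f_1,\dots,f_m)).$$
   Context: An $H$-space is a space $G$ with a multiplication $\mu\colon G\times G\to G$ and an identity element $e$ such that $\mu|_{G\times\{e\}}\simeq\mathrm{id}_G\simeq\mu|_{\{e\}\times G}$ (not necessarily homotopy-associative). A group-like space is a homotopy-associative $H$-space with an inversion $\eta\colon G\to G$ such that $\mu\circ(\mathrm{id}\times\eta)\circ\Delta\simeq c_e\simeq\mu\circ(\eta\times\mathrm{id})\circ\Delta$, where $\Delta$ is the diagonal and $c_e$ the constant map at $e$; it need not have the homotopy type of a CW complex. The map $F$: if $G$ is group-like, $F=\mu\circ(\mathrm{id}_G\times\eta)$. If $G$ is a path-connected CW $H$-space (not assumed group-like), $F\colon G\times G\to G$ is a map, unique up to homotopy (James), with $\mu\circ(F,\mathrm{pr}_2)\simeq\mathrm{pr}_1$, where $\mathrm{pr}_i\colon G\times G\to G$ are the projections. For a (Hurewicz)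 fibration $p\colon E\to B$, $\mathsf{secat}(p)$ is the least $n\ge 0$ such that $B$ is covered by $n+1$ open sets over each of which $p$ has a continuous partial section. For $k\ge1$ let $E_k(p)$ be the space of probability measures $\sum_{i=1}^k\lambda_ie_i$ on $E$ supported on at most $k$ points, all in a single fiber of $p$, as a subspace of the space $\mathcal B_k(E)$ of probability measures with support of size at most $k$ (with the L\'evy--Prokhorov metric topology when $E$ is metrizable; the results are asserted equally for the quotient topology from the symmetric join $\ast^kE/\Sigma_k$), and $p_k\colon E_k(p)\to B$, $p_k(\sum\lambda_ie_i)=p(e_i)$. $\mathsf{dsecat}(p)$ is the least $n\ge0$ such that $p_{n+1}$ has a continuous section. Fix times $0=t_1<\dots<t_m=1$ and let $\pi^Y_m\colon Y^I\to Y^m$, $\gamma\mapsto(\gamma(t_1),\dots,\gamma(t_m))$. For maps $f_1,\dots,f_m\colon X\to Y$, $\mathsf{D}(f_1,\dots,f_m)$ is the least $n\ge0$ such that $X$ is covered by $n+1$ open sets on each of which the restrictions of all the $f_i$ are mutually homotopic; equivalently it is $\mathsf{secat}((f_1,\dots,f_m)^*\pi^Y_m)$. Also $\mathsf{dD}(f_1,\dots,f_m):=\mathsf{dsecat}((f_1,\dots,f_m)^*\pi^Y_m)$. For a map $f\colon X\to Y$, with $P_0(Y)\subset Y^I$ the paths ending at the basepoint and $p^Y\colon P_0(Y)\to Y$, $\gamma\mapsto\gamma(0)$: $\mathsf{cat}(f):=\mathsf{secat}(f^*p^Y)$ and $\mathsf{dcat}(f):=\mathsf{dsecat}(f^*p^Y)$.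 *)

theory Defs
  imports
    "HOL-Probability.Probability_Mass_Function"
    "HOL-Homology.Simplices"
    "HOL-Library.Extended_Nat"
begin

section \<open>H-spaces, group-like spaces and CW complexes\<close>

text \<open>
  All topological notions refer to abstract topologies, so that a space is an arbitrary
  topological space (no separation axiom). Products carry the product topology, maps are
  unpointed and homotopies are free.
\<close>

definition H_space :: "'g topology \<Rightarrow> ('g \<times> 'g \<Rightarrow> 'g) \<Rightarrow> 'g \<Rightarrow> bool" where
  "H_space G \<mu> e \<longleftrightarrow>
     e \<in> topspace G \<and>
     continuous_map (prod_topology G G) G \<mu> \<and>
     homotopic_with (\<lambda>_. True) G G (\<lambda>x. \<mu> (x, e)) id \<and>
     homotopic_with (\<lambda>_. True) G G (\<lambda>x. \<mu> (e, x)) id"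

definition group_like_space ::
    "'g topology \<Rightarrow> ('g \<times> 'g \<Rightarrow> 'g) \<Rightarrow> 'g \<Rightarrow> ('g \<Rightarrow> 'g) \<Rightarrow> bool" where
  "group_like_space G \<mu> e \<eta> \<longleftrightarrow>
     H_space G \<mu> e \<and>
     homotopic_with (\<lambda>_. True) (prod_topology G (prod_topology G G)) G
       (\<lambda>(x, y, z). \<mu> (\<mu> (x, y), z)) (\<lambda>(x, y, z). \<mu> (x, \<mu> (y, z))) \<and>
     continuous_map G G \<eta> \<and>
     homotopic_with (\<lambda>_. True) G G (\<lambda>x. \<mu> (x, \<eta> x)) (\<lambda>_. e) \<and>
     homotopic_with (\<lambda>_. True) G G (\<lambda>x. \<mu> (\<eta> x, x)) (\<lambda>_. e)"

definition closed_disc :: "nat \<Rightarrow> (nat \<Rightarrow> real) set" where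
  "closed_disc n = {x \<in> topspace (Euclidean_space n). (\<Sum>i<n. x i ^ 2) \<le> 1}"

definition open_disc :: "nat \<Rightarrow> (nat \<Rightarrow> real) set" where
  "open_disc n = {x \<in> topspace (Euclidean_space n). (\<Sum>i<n. x i ^ 2) < 1}"

text \<open>
  A CW structure is a set \<open>C\<close> of pairs consisting of a dimension \<open>n\<close> and a characteristic
  map on the closed \<open>n\<close>-disc. The clauses are, in order: the interiors of the cells embed,
  they are disjoint, they cover the space, closure-finiteness, and the weak topology.
\<close>

definition CW_structure ::
    "'a topology \<Rightarrow> (nat \<times> ((nat \<Rightarrow> real) \<Rightarrow> 'a)) set \<Rightarrow> bool" where
  "CW_structure X C \<longleftrightarrow>
     Hausdorff_space X \<and>
     (\<forall>(n, \<phi>) \<in> C.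
        continuous_map (subtopology (Euclidean_space n) (closed_disc n)) X \<phi> \<and>
        embedding_map (subtopology (Euclidean_space n) (open_disc n)) X \<phi>) \<and>
     pairwise (\<lambda>(n, \<phi>) (k, \<psi>). disjnt (\<phi> ` open_disc n) (\<psi> ` open_disc k)) C \<and>
     (\<Union>(n, \<phi>) \<in> C. \<phi> ` open_disc n) = topspace X \<and>
     (\<forall>(n, \<phi>) \<in> C. \<exists>C'. C' \<subseteq> C \<and> finite C' \<and> (\<forall>(k, \<psi>) \<in> C'. k < n) \<and>
        \<phi> ` (closed_disc n - open_disc n) \<subseteq> (\<Union>(k, \<psi>) \<in> C'. \<psi> ` open_disc k)) \<and>
     (\<forall>A. A \<subseteq> topspace X \<longrightarrow>
        (closedin X A \<longleftrightarrow>
          (\<forall>(n, \<phi>) \<in> C. closedin (subtopology (Euclidean_space n) (closed_disc n))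
                           {x \<in> closed_disc n. \<phi> x \<in> A})))"

definition CW_complex :: "'a topology \<Rightarrow> bool" where
  "CW_complex X \<longleftrightarrow> (\<exists>C. CW_structure X C)"

text \<open>
  For a path-connected CW H-space the difference map is any map with the property below; it
  exists and is unique up to homotopy by a theorem of James, which is not built in here.
\<close>

definition James_difference ::
    "'g topology \<Rightarrow> ('g \<times> 'g \<Rightarrow> 'g) \<Rightarrow> ('g \<times> 'g \<Rightarrow> 'g) \<Rightarrow> bool" where
  "James_difference G \<mu> F \<longleftrightarrow>
     continuous_map (prod_topology G G) G F \<and>
     homotopic_with (\<lambda>_. True) (prod_topology G G) G (\<lambda>z. \<mu> (F z, snd z)) fst"


section \<open>Powers and path spaces\<close>

abbreviation power_top :: "'a topology \<Rightarrow> nat \<Rightarrow> (nat \<Rightarrow> 'a) topology" where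
  "power_top Y m \<equiv> product_topology (\<lambda>_. Y) {1..m}"

definition tuple_map :: "nat \<Rightarrow> (nat \<Rightarrow> 'x \<Rightarrow> 'a) \<Rightarrow> 'x \<Rightarrow> (nat \<Rightarrow> 'a)" where
  "tuple_map m f x = (\<lambda>i\<in>{1..m}. f i x)"

definition diff_map :: "nat \<Rightarrow> ('g \<times> 'g \<Rightarrow> 'g) \<Rightarrow> (nat \<Rightarrow> 'g) \<Rightarrow> (nat \<Rightarrow> 'g)" where
  "diff_map m F x = (\<lambda>i\<in>{1..m-1}. F (x i, x (Suc i)))"

definition compact_open_topology :: "'a topology \<Rightarrow> 'b topology \<Rightarrow> ('a \<Rightarrow> 'b) topology" where
  "compact_open_topology X Y =
     topology_generated_by
       {{g \<in> extensional (topspace X). continuous_map X Y g \<and> g ` K \<subseteq> U} |K U.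
          compactin X K \<and> openin Y U}"

lemma topspace_compact_open:
  "topspace (compact_open_topology X Y) = {g \<in> extensional (topspace X). continuous_map X Y g}"
  unfolding compact_open_topology_def topology_generated_by_topspace
  by (auto intro!: exI[of _ "{}"])

definition path_space :: "'a topology \<Rightarrow> (real \<Rightarrow> 'a) topology" where
  "path_space Y = compact_open_topology (top_of_set {0..1}) Y"

definition based_path_space :: "'a topology \<Rightarrow> 'a \<Rightarrow> (real \<Rightarrow> 'a) topology" where
  "based_path_space Y y0 = subtopology (path_space Y) {\<gamma>. \<gamma> 1 = y0}"

definition path_eval :: "nat \<Rightarrow> (nat \<Rightarrow> real) \<Rightarrow> (real \<Rightarrow> 'a) \<Rightarrow> (nat \<Rightarrow> 'a)" where
  "path_eval m t \<gamma> = (\<lambda>i\<in>{1..m}. \<gamma> (t i))"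

text \<open>Total space of the pullback \<open>f\<^sup>*p\<close>; its projection to \<open>X\<close> is \<^const>\<open>fst\<close>.\<close>

definition pullback_space ::
    "'x topology \<Rightarrow> 'e topology \<Rightarrow> ('x \<Rightarrow> 'b) \<Rightarrow> ('e \<Rightarrow> 'b) \<Rightarrow> ('x \<times> 'e) topology" where
  "pullback_space X E f p = subtopology (prod_topology X E) {(x, z). f x = p z}"


section \<open>Finitely supported probability measures\<close>

definition fin_measures :: "nat \<Rightarrow> 'e set \<Rightarrow> 'e pmf set" where
  "fin_measures k E = {\<nu>. set_pmf \<nu> \<subseteq> E \<and> finite (set_pmf \<nu>) \<and> card (set_pmf \<nu>) \<le> k}"

subsection \<open>The quotient topology\<close>

definition quotient_topology :: "'a topology \<Rightarrow> ('a \<Rightarrow> 'b) \<Rightarrow> 'b topology" where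
  "quotient_topology X q =
     topology (\<lambda>U. U \<subseteq> q ` topspace X \<and> openin X {x \<in> topspace X. q x \<in> U})"

lemma openin_quotient_topology:
  "openin (quotient_topology X q) U \<longleftrightarrow>
     U \<subseteq> q ` topspace X \<and> openin X {x \<in> topspace X. q x \<in> U}"
proof -
  have int: "{x \<in> topspace X. q x \<in> S \<inter> T} =
      {x \<in> topspace X. q x \<in> S} \<inter> {x \<in> topspace X. q x \<in> T}" for S T
    by auto
  have un: "{x \<in> topspace X. q x \<in> \<Union>\<K>} = (\<Union>S\<in>\<K>. {x \<in> topspace X. q x \<in> S})" for \<K>
    by auto
  have "istopology (\<lambda>U. U \<subseteq> q ` topspace X \<and> openin X {x \<in> topspace X. q x \<in> U})"
    unfolding istopology_def int un by (auto intro!: openin_Union)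
  then show ?thesis
    by (simp add: quotient_topology_def topology_inverse')
qed

lemma topspace_quotient_topology: "topspace (quotient_topology X q) = q ` topspace X"
proof -
  have "openin X {x \<in> topspace X. q x \<in> q ` topspace X}"
    by (rule back_subst[of "openin X", OF openin_topspace]) auto
  then show ?thesis
    by (metis openin_quotient_topology openin_subset openin_topspace subset_antisym subset_refl)
qed

lemma quotient_map_quotient_topology: "quotient_map X (quotient_topology X q) q"
  by (auto simp: quotient_map_def openin_quotient_topology topspace_quotient_topology)

text \<open>
  The measure \<open>\<Sum>i<k. t\<^sub>i x\<^sub>i\<close> is the image of the weights \<open>t\<close>, seen as a measure on \<open>{..<k}\<close>,
  under \<open>i \<mapsto> x\<^sub>i\<close>. The parameter space is the product of the \<open>(k-1)\<close>-simplex with the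
  \<open>k\<close>-th power of \<open>E\<close>. Passing to the \<open>k\<close>-fold join (points with weight zero are dropped),
  then to the symmetric join (orbits of \<open>\<Sigma>\<^sub>k\<close>), then to measures (weights of equal points are
  added) is a chain of three quotient maps whose composite is \<open>barycenter\<close>, and a composite
  of quotient maps is a quotient map.
\<close>

definition barycenter :: "(nat \<Rightarrow> real) \<times> (nat \<Rightarrow> 'e) \<Rightarrow> 'e pmf" where
  "barycenter = (\<lambda>(t, x). map_pmf x (embed_pmf t))"

definition join_measures :: "'e topology \<Rightarrow> nat \<Rightarrow> 'e pmf topology" where
  "join_measures E k =
     quotient_topology
       (prod_topology (subtopology (powertop_real UNIV) (standard_simplex (k - 1)))
                      (product_topology (\<lambda>_. E) {..<k}))
       barycenter"

lemma barycenter_in_fin_measures: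
  assumes "t \<in> standard_simplex (k - 1)" "x \<in> {..<k} \<rightarrow>\<^sub>E E" "k \<ge> 1"
  shows "barycenter (t, x) \<in> fin_measures k E"
proof -
  have t: "\<And>i. 0 \<le> t i" "\<And>i. i \<ge> k \<Longrightarrow> t i = 0" "(\<Sum>i<k. t i) = 1"
    using assms(1,3) lessThan_Suc_atMost[of "k - 1"] by (auto simp: standard_simplex_def)
  have "(\<integral>\<^sup>+ i. ennreal (t i) \<partial>count_space UNIV) = (\<Sum>i<k. ennreal (t i))"
    by (rule nn_integral_count_space'[of "{..<k}"]) (auto simp: t not_less)
  also have "\<dots> = ennreal (\<Sum>i<k. t i)" by (rule sum_ennreal) (simp add: t)
  finally have "(\<integral>\<^sup>+ i. ennreal (t i) \<partial>count_space UNIV) = 1" by (simp add: t)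
  then have "set_pmf (embed_pmf t) = {i. t i \<noteq> 0}"
    using t(1) by (intro set_embed_pmf) auto
  also have "\<dots> \<subseteq> {..<k}" using t(2) not_less by auto
  finally have s: "set_pmf (embed_pmf t) \<subseteq> {..<k}" .
  then have "card (x ` set_pmf (embed_pmf t)) \<le> k"
    by (metis card_image_le card_lessThan card_mono finite_lessThan finite_subset le_trans)
  then show ?thesis
    using assms(2) s finite_subset[OF s] by (auto simp: barycenter_def fin_measures_def)
qed

lemma fin_measures_eq_barycenter:
  assumes "\<nu> \<in> fin_measures k E" "k \<ge> 1"
  obtains t x where "t \<in> standard_simplex (k - 1)" "x \<in> {..<k} \<rightarrow>\<^sub>E E" "\<nu> = barycenter (t, x)"
proof -
  have fin: "finite (set_pmf \<nu>)" "card (set_pmf \<nu>) \<le> k" "set_pmf \<nu> \<subseteq> E"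
    using assms by (auto simp: fin_measures_def)
  then obtain j where j: "inj_on j (set_pmf \<nu>)" "j ` set_pmf \<nu> \<subseteq> {..<k}"
    using card_le_inj[of "set_pmf \<nu>" "{..<k}"] by auto
  obtain z where z: "z \<in> set_pmf \<nu>" using set_pmf_not_empty[of \<nu>] by blast
  define x where "x = (\<lambda>i\<in>{..<k}. if i \<in> j ` set_pmf \<nu> then inv_into (set_pmf \<nu>) j i else z)"
  define q where "q = map_pmf j \<nu>"
  have q: "set_pmf q \<subseteq> {..<k}" using j by (simp add: q_def)
  have "pmf q i = 0" if "i > k - 1" for i
    using q that assms(2) by (force simp: set_pmf_iff)
  moreover have "(\<Sum>i\<le>k - 1. pmf q i) = 1"
    using q assms(2) lessThan_Suc_atMost[of "k - 1"] by (intro sum_pmf_eq_1) auto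
  ultimately have "pmf q \<in> standard_simplex (k - 1)"
    by (simp add: standard_simplex_def pmf_le_1)
  moreover have "x \<in> {..<k} \<rightarrow>\<^sub>E E"
    using z fin(3) inv_into_into[of _ j "set_pmf \<nu>"] by (auto simp: x_def)
  moreover have "barycenter (pmf q, x) = \<nu>"
  proof -
    have "embed_pmf (pmf q) = q"
      using type_definition.Rep_inverse[OF td_pmf_embed_pmf] .
    then have "barycenter (pmf q, x) = map_pmf (x \<circ> j) \<nu>"
      by (simp add: barycenter_def q_def pmf.map_comp)
    also have "\<dots> = map_pmf id \<nu>"
      using j by (intro map_pmf_cong) (auto simp: x_def)
    finally show ?thesis by simp
  qed
  ultimately show ?thesis using that by metis
qed

lemma topspace_join_measures:
  assumes "k \<ge> 1"
  shows "topspace (join_measures E k) = fin_measures k (topspace E)"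
proof -
  have "topspace (join_measures E k) =
      barycenter ` (standard_simplex (k - 1) \<times> ({..<k} \<rightarrow>\<^sub>E topspace E))"
    by (simp add: join_measures_def topspace_quotient_topology topspace_standard_simplex o_def)
  also have "\<dots> = fin_measures k (topspace E)"
  proof (intro equalityI subsetI)
    fix \<nu> assume "\<nu> \<in> barycenter ` (standard_simplex (k - 1) \<times> ({..<k} \<rightarrow>\<^sub>E topspace E))"
    then obtain t x where "t \<in> standard_simplex (k - 1)" "x \<in> {..<k} \<rightarrow>\<^sub>E topspace E"
      "\<nu> = barycenter (t, x)"
      by (elim imageE SigmaE) simp
    then show "\<nu> \<in> fin_measures k (topspace E)"
      using barycenter_in_fin_measures[OF _ _ assms] by simp
  next
    fix \<nu> assume "\<nu> \<in> fin_measures k (topspace E)"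
    then obtain t x where "t \<in> standard_simplex (k - 1)" "x \<in> {..<k} \<rightarrow>\<^sub>E topspace E"
      "\<nu> = barycenter (t, x)"
      using fin_measures_eq_barycenter assms by blast
    then show "\<nu> \<in> barycenter ` (standard_simplex (k - 1) \<times> ({..<k} \<rightarrow>\<^sub>E topspace E))"
      by (intro image_eqI[of _ _ "(t, x)"] SigmaI)
  qed
  finally show ?thesis .
qed

subsection \<open>The Levy--Prokhorov metric\<close>

definition metric_nbhd :: "'e metric \<Rightarrow> 'e set \<Rightarrow> real \<Rightarrow> 'e set" where
  "metric_nbhd M A r = {y \<in> mspace M. \<exists>a\<in>A. mdist M a y < r}"

definition LP_close :: "'e metric \<Rightarrow> 'e pmf \<Rightarrow> 'e pmf \<Rightarrow> real \<Rightarrow> bool" where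
  "LP_close M \<nu> \<rho> r \<longleftrightarrow>
     (\<forall>A \<in> sigma_sets (mspace M) {U. openin (mtopology_of M) U}.
        measure_pmf.prob \<nu> A \<le> measure_pmf.prob \<rho> (metric_nbhd M A r) + r \<and>
        measure_pmf.prob \<rho> A \<le> measure_pmf.prob \<nu> (metric_nbhd M A r) + r)"

definition LP_dist :: "'e metric \<Rightarrow> 'e pmf \<Rightarrow> 'e pmf \<Rightarrow> real" where
  "LP_dist M \<nu> \<rho> = Inf {r. r > 0 \<and> LP_close M \<nu> \<rho> r}"

lemma metric_nbhd_open: "openin (mtopology_of M) (metric_nbhd M A r)" if "A \<subseteq> mspace M"
proof -
  interpret Metric_space "mspace M" "mdist M" by (rule Metric_space_mspace_mdist)
  have "metric_nbhd M A r = (\<Union>a\<in>A. mball a r)"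
    using that unfolding metric_nbhd_def by (auto simp: subset_iff)
  then show ?thesis by (auto simp: mtopology_of_def)
qed

lemma LP_close_mono: "LP_close M \<nu> \<rho> r \<Longrightarrow> r \<le> s \<Longrightarrow> LP_close M \<nu> \<rho> s"
proof -
  assume r: "LP_close M \<nu> \<rho> r" "r \<le> s"
  have "metric_nbhd M A r \<subseteq> metric_nbhd M A s" for A
    using r(2) by (force simp: metric_nbhd_def)
  then have "measure_pmf.prob \<rho> (metric_nbhd M A r) \<le> measure_pmf.prob \<rho> (metric_nbhd M A s)" for A \<rho>
    by (intro measure_pmf.finite_measure_mono) auto
  then show ?thesis
    using r unfolding LP_close_def by (smt (verit))
qed

lemma LP_close_1: "LP_close M \<nu> \<rho> 1"
  unfolding LP_close_def by (smt (verit) measure_nonneg measure_pmf.prob_le_1)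

lemma LP_dist_less_iff: "LP_dist M \<nu> \<rho> < s \<longleftrightarrow> (\<exists>r. 0 < r \<and> r < s \<and> LP_close M \<nu> \<rho> r)"
proof -
  have "{r. 0 < r \<and> LP_close M \<nu> \<rho> r} \<noteq> {}" using LP_close_1 zero_less_one by blast
  moreover have "bdd_below {r. 0 < r \<and> LP_close M \<nu> \<rho> r}" by (rule bdd_belowI[of _ 0]) auto
  ultimately show ?thesis unfolding LP_dist_def by (subst cInf_less_iff) auto
qed

lemma LP_close_trans:
  assumes "LP_close M \<nu> \<rho> r" "LP_close M \<rho> \<sigma> s"
  shows "LP_close M \<nu> \<sigma> (r + s)"
  unfolding LP_close_def
proof (intro ballI)
  let ?B = "sigma_sets (mspace M) {U. openin (mtopology_of M) U}"
  fix A assume A: "A \<in> ?B"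
  have sub: "A \<subseteq> mspace M"
    by (rule sigma_sets_into_sp[OF _ A]) (use openin_subset in fastforce)
  have B: "metric_nbhd M A q \<in> ?B" for q
    using metric_nbhd_open[OF sub] by auto
  have incl: "metric_nbhd M (metric_nbhd M A p) q \<subseteq> metric_nbhd M A (p + q)" for p q
    using sub unfolding metric_nbhd_def
    by (auto, smt (verit) mdist_triangle subsetD)
  then have le: "measure_pmf.prob \<tau> (metric_nbhd M (metric_nbhd M A p) q)
      \<le> measure_pmf.prob \<tau> (metric_nbhd M A (p + q))" for p q \<tau>
    by (intro measure_pmf.finite_measure_mono) auto
  show "measure_pmf.prob \<nu> A \<le> measure_pmf.prob \<sigma> (metric_nbhd M A (r + s)) + (r + s) \<and>
        measure_pmf.prob \<sigma> A \<le> measure_pmf.prob \<nu> (metric_nbhd M A (r + s)) + (r + s)"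
    using assms A B[of r] B[of s] le[of \<sigma> r s] le[of \<nu> s r]
    unfolding LP_close_def by (smt (verit))
qed

lemma LP_dist_zero_imp_le:
  assumes "LP_dist M \<nu> \<rho> = 0" "finite (set_pmf \<rho>)" "set_pmf \<rho> \<subseteq> mspace M" "x \<in> mspace M"
  shows "pmf \<nu> x \<le> pmf \<rho> x"
proof (rule field_le_epsilon)
  fix \<epsilon> :: real assume "\<epsilon> > 0"
  interpret Metric_space "mspace M" "mdist M" by (rule Metric_space_mspace_mdist)
  define D where "D = insert \<epsilon> (mdist M x ` (set_pmf \<rho> - {x}))"
  have D: "finite D" "D \<noteq> {}" "\<And>d. d \<in> D \<Longrightarrow> 0 < d"
    using assms \<open>\<epsilon> > 0\<close> by (auto simp: D_def mdist_pos_eq)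
  then have "0 < Min D" by simp
  then obtain r where r: "0 < r" "r < Min D" "LP_close M \<nu> \<rho> r"
    using LP_dist_less_iff[of M \<nu> \<rho> "Min D"] assms(1) by auto
  have "closedin mtopology {x}" using assms(4) closedin_t1_singleton t1_space_mtopology
    by (simp add: closedin_Hausdorff_singleton Hausdorff_space_mtopology)
  then have "mspace M - (mspace M - {x}) \<in> sigma_sets (mspace M) {U. openin (mtopology_of M) U}"
    by (intro sigma_sets.Compl sigma_sets.Basic)
       (auto simp: closedin_def mtopology_of_def)
  moreover have "mspace M - (mspace M - {x}) = {x}" using assms(4) by auto
  ultimately have "measure_pmf.prob \<nu> {x} \<le> measure_pmf.prob \<rho> (metric_nbhd M {x} r) + r"
    using r(3) unfolding LP_close_def by auto
  moreover have "measure_pmf.prob \<rho> (metric_nbhd M {x} r) \<le> measure_pmf.prob \<rho> {x}"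
  proof -
    have "metric_nbhd M {x} r \<inter> set_pmf \<rho> \<subseteq> {x}"
    proof
      fix y assume y: "y \<in> metric_nbhd M {x} r \<inter> set_pmf \<rho>"
      show "y \<in> {x}"
      proof (rule ccontr)
        assume "y \<notin> {x}"
        then have "Min D \<le> mdist M x y" using y D(1) by (intro Min_le) (auto simp: D_def)
        then show False using y r by (auto simp: metric_nbhd_def)
      qed
    qed
    then have "measure_pmf.prob \<rho> (metric_nbhd M {x} r \<inter> set_pmf \<rho>) \<le> measure_pmf.prob \<rho> {x}"
      by (intro measure_pmf.finite_measure_mono) auto
    then show ?thesis by (simp add: measure_Int_set_pmf)
  qed
  moreover have "Min D \<le> \<epsilon>" using D(1) by (intro Min_le) (auto simp: D_def)
  ultimately show "pmf \<nu> x \<le> pmf \<rho> x + \<epsilon>" using r by (simp add: pmf.rep_eq)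
qed

lemma Metric_space_LP_dist: "Metric_space (fin_measures k (mspace M)) (LP_dist M)"
proof
  show "0 \<le> LP_dist M \<nu> \<rho>" for \<nu> \<rho>
    using LP_dist_less_iff[of M \<nu> \<rho> 0] by fastforce
  show sym: "LP_dist M \<nu> \<rho> = LP_dist M \<rho> \<nu>" for \<nu> \<rho>
    by (auto simp: LP_dist_def LP_close_def intro!: arg_cong[of _ _ Inf])
  show "LP_dist M \<nu> \<rho> = 0 \<longleftrightarrow> \<nu> = \<rho>"
    if "\<nu> \<in> fin_measures k (mspace M)" "\<rho> \<in> fin_measures k (mspace M)" for \<nu> \<rho>
  proof
    assume z: "LP_dist M \<nu> \<rho> = 0"
    show "\<nu> = \<rho>"
    proof (rule pmf_eqI)
      fix x show "pmf \<nu> x = pmf \<rho> x"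
      proof (cases "x \<in> mspace M")
        case True
        then show ?thesis
          using LP_dist_zero_imp_le[of M \<nu> \<rho> x] LP_dist_zero_imp_le[of M \<rho> \<nu> x] z that
          by (auto simp: fin_measures_def sym[of \<rho> \<nu>] intro: antisym)
      next
        case False
        then have "x \<notin> set_pmf \<nu>" "x \<notin> set_pmf \<rho>" using that by (auto simp: fin_measures_def)
          then show ?thesis by (simp add: set_pmf_iff)
      qed
    qed
  next
    assume eq: "\<nu> = \<rho>"
    have "LP_close M \<rho> \<rho> r" if "r > 0" for r
      unfolding LP_close_def
    proof (intro ballI)
      fix A assume A: "A \<in> sigma_sets (mspace M) {U. openin (mtopology_of M) U}"
      have "A \<subseteq> mspace M"
        by (rule sigma_sets_into_sp[OF _ A]) (use openin_subset in fastforce)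
      then have "A \<subseteq> metric_nbhd M A r" using that Metric_space.zero[OF Metric_space_mspace_mdist]
        unfolding metric_nbhd_def subset_iff by (metis (mono_tags, lifting) mem_Collect_eq)
      then have "measure_pmf.prob \<rho> A \<le> measure_pmf.prob \<rho> (metric_nbhd M A r)"
        by (intro measure_pmf.finite_measure_mono) auto
      then show "measure_pmf.prob \<rho> A \<le> measure_pmf.prob \<rho> (metric_nbhd M A r) + r \<and>
        measure_pmf.prob \<rho> A \<le> measure_pmf.prob \<rho> (metric_nbhd M A r) + r" using that by simp
    qed
    then have "{r. 0 < r \<and> LP_close M \<nu> \<rho> r} = {0<..}" using eq by auto
    then show "LP_dist M \<nu> \<rho> = 0" by (simp add: LP_dist_def)
  qed
  show "LP_dist M \<nu> \<sigma> \<le> LP_dist M \<nu> \<rho> + LP_dist M \<rho> \<sigma>" for \<nu> \<rho> \<sigma>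
  proof (rule field_le_epsilon)
    fix \<epsilon> :: real assume "\<epsilon> > 0"
    obtain r where r: "0 < r" "r < LP_dist M \<nu> \<rho> + \<epsilon>/2" "LP_close M \<nu> \<rho> r"
      using LP_dist_less_iff[of M \<nu> \<rho> "LP_dist M \<nu> \<rho> + \<epsilon>/2"] \<open>\<epsilon> > 0\<close> by auto
    obtain s where s: "0 < s" "s < LP_dist M \<rho> \<sigma> + \<epsilon>/2" "LP_close M \<rho> \<sigma> s"
      using LP_dist_less_iff[of M \<rho> \<sigma> "LP_dist M \<rho> \<sigma> + \<epsilon>/2"] \<open>\<epsilon> > 0\<close> by auto
    have "LP_dist M \<nu> \<sigma> < LP_dist M \<nu> \<rho> + LP_dist M \<rho> \<sigma> + \<epsilon>"
      unfolding LP_dist_less_iff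
      by (rule exI[of _ "r + s"]) (use r s LP_close_trans in auto)
    then show "LP_dist M \<nu> \<sigma> \<le> LP_dist M \<nu> \<rho> + LP_dist M \<rho> \<sigma> + \<epsilon>" by simp
  qed
qed

definition LP_measures :: "'e metric \<Rightarrow> nat \<Rightarrow> 'e pmf topology" where
  "LP_measures M k = Metric_space.mtopology (fin_measures k (mspace M)) (LP_dist M)"


section \<open>Sectional category and its distributional version\<close>

text \<open>The infimum of the empty set is \<open>\<infinity>\<close>.\<close>

definition secat :: "'e topology \<Rightarrow> 'b topology \<Rightarrow> ('e \<Rightarrow> 'b) \<Rightarrow> enat" where
  "secat E B p =
     Inf {enat n |n. \<exists>U. (\<Union>i\<le>n. U i) = topspace B \<and>
            (\<forall>i\<le>n. openin B (U i) \<and>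
               (\<exists>s. continuous_map (subtopology B (U i)) E s \<and> (\<forall>b \<in> U i. p (s b) = b)))}"

text \<open>
  In the following two definitions \<open>T k\<close> is the space of probability measures on \<open>E\<close> with at
  most \<open>k\<close> points in the support, with one of the topologies above.
\<close>

definition fibre_measures ::
    "(nat \<Rightarrow> 'e pmf topology) \<Rightarrow> ('e \<Rightarrow> 'b) \<Rightarrow> nat \<Rightarrow> 'e pmf topology" where
  "fibre_measures T p k = subtopology (T k) {\<nu>. \<exists>b. \<forall>z \<in> set_pmf \<nu>. p z = b}"

definition dsecat_wrt ::
    "(nat \<Rightarrow> 'e pmf topology) \<Rightarrow> 'b topology \<Rightarrow> ('e \<Rightarrow> 'b) \<Rightarrow> enat" where
  "dsecat_wrt T B p =
     Inf {enat n |n. \<exists>s. continuous_map B (fibre_measures T p (n + 1)) s \<and>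
            (\<forall>b \<in> topspace B. the_elem (p ` set_pmf (s b)) = b)}"

definition dsecat :: "'e topology \<Rightarrow> 'b topology \<Rightarrow> ('e \<Rightarrow> 'b) \<Rightarrow> enat" where
  "dsecat E B p = dsecat_wrt (join_measures E) B p"

definition dsecat_LP :: "'e metric \<Rightarrow> 'b topology \<Rightarrow> ('e \<Rightarrow> 'b) \<Rightarrow> enat" where
  "dsecat_LP M B p = dsecat_wrt (LP_measures M) B p"


section \<open>Homotopic distance and category of maps\<close>

definition hdist :: "'x topology \<Rightarrow> 'y topology \<Rightarrow> nat \<Rightarrow> (nat \<Rightarrow> 'x \<Rightarrow> 'y) \<Rightarrow> enat" where
  "hdist X Y m f =
     Inf {enat n |n. \<exists>U. (\<Union>j\<le>n. U j) = topspace X \<and>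
            (\<forall>j\<le>n. openin X (U j) \<and>
               (\<forall>i\<in>{1..m}. \<forall>i'\<in>{1..m}.
                  homotopic_with (\<lambda>_. True) (subtopology X (U j)) Y (f i) (f i')))}"

definition hdist_space ::
    "'x topology \<Rightarrow> 'y topology \<Rightarrow> nat \<Rightarrow> (nat \<Rightarrow> real) \<Rightarrow> (nat \<Rightarrow> 'x \<Rightarrow> 'y)
      \<Rightarrow> ('x \<times> (real \<Rightarrow> 'y)) topology" where
  "hdist_space X Y m t f = pullback_space X (path_space Y) (tuple_map m f) (path_eval m t)"

definition dhdist ::
    "'x topology \<Rightarrow> 'y topology \<Rightarrow> nat \<Rightarrow> (nat \<Rightarrow> real) \<Rightarrow> (nat \<Rightarrow> 'x \<Rightarrow> 'y) \<Rightarrow> enat" where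
  "dhdist X Y m t f = dsecat (hdist_space X Y m t f) X fst"

definition cat_space ::
    "'x topology \<Rightarrow> 'y topology \<Rightarrow> 'y \<Rightarrow> ('x \<Rightarrow> 'y) \<Rightarrow> ('x \<times> (real \<Rightarrow> 'y)) topology" where
  "cat_space X Y y0 f = pullback_space X (based_path_space Y y0) f (\<lambda>\<gamma>. \<gamma> 0)"

definition cat :: "'x topology \<Rightarrow> 'y topology \<Rightarrow> 'y \<Rightarrow> ('x \<Rightarrow> 'y) \<Rightarrow> enat" where
  "cat X Y y0 f = secat (cat_space X Y y0 f) X fst"

definition dcat :: "'x topology \<Rightarrow> 'y topology \<Rightarrow> 'y \<Rightarrow> ('x \<Rightarrow> 'y) \<Rightarrow> enat" where
  "dcat X Y y0 f = dsecat (cat_space X Y y0 f) X fst"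

end

theory Submission
  imports Defs
begin

text \<open>
  Two path fibrations over \<open>X\<close> are compared: a point of the first total space over \<open>x\<close> is a path
  through \<open>f 1 x, \<dots>, f m x\<close> at the given times, a point of the second one is a path from \<open>g x\<close> to
  the constant tuple \<open>e'\<close>. There are maps over \<open>X\<close> between the total spaces in both directions.
  Measures can be pushed forward along such maps, continuously for either topology, and so the
  distributional invariants agree (\<open>dsecat_mono\<close>, \<open>dsecat_LP_mono\<close>).

  A map over \<open>X\<close> into one of the total spaces is, by the exponential law, a homotopy or a chain of
  homotopies between maps into \<open>G\<close>. So everything reduces to the following statement for
  arbitrary maps \<open>a, b\<close> from a space \<open>U\<close> to \<open>G\<close>: they are homotopic if and only if \<open>F (a, b)\<close> is
  homotopic to the constant map \<open>e\<close> (\<open>homotopic_iff_null_difference\<close>). Applied to the total spaces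
  it gives the maps over \<open>X\<close>; applied to open subsets of \<open>X\<close> it shows that the same covers compute
  the homotopic distance and the category.

  This statement needs two properties of \<open>F\<close>: that \<open>\<mu> (F (x, y), y)\<close> is homotopic to \<open>x\<close>, and that
  \<open>F (x, x)\<close> is homotopic to \<open>e\<close>. For a group-like space they follow from the group laws. For a CW
  H-space the first one is the definition of \<open>F\<close>, and the second one says that \<open>F (x, x)\<close> and \<open>e\<close>,
  whose translates by \<open>x\<close> are homotopic, are homotopic themselves. This is right cancellation
  (\<open>CW_right_cancellation\<close>), the uniqueness part of the theorem of James, and it is proved by
  obstruction theory: as \<open>G\<close> is path-connected and has a unit up to homotopy, each right
  translation is homotopic to the identity, so its homotopy fibres are contractible
  (\<open>homotopy_fibre_contraction\<close>), partial lifts extend over discs (\<open>lift_extension\<close>), and a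
  homotopy is assembled from the cells (\<open>CW_section_exists\<close>).
\<close>

section \<open>Continuous families of paths\<close>

abbreviation unit_interval :: "real topology" where
  "unit_interval \<equiv> top_of_set {0..1}"

abbreviation homotopic_maps :: "'a topology \<Rightarrow> 'b topology \<Rightarrow> ('a \<Rightarrow> 'b) \<Rightarrow> ('a \<Rightarrow> 'b) \<Rightarrow> bool" where
  "homotopic_maps \<equiv> homotopic_with (\<lambda>_. True)"

text \<open>
  Times are clamped into the unit interval, so that every piece of a homotopy defined by cases
  is continuous on the whole domain.
\<close>

definition unit_clamp :: "real \<Rightarrow> real" where
  "unit_clamp x = max 0 (min 1 x)"

lemma unit_clamp_id [simp]: "0 \<le> x \<Longrightarrow> x \<le> 1 \<Longrightarrow> unit_clamp x = x"
  by (simp add: unit_clamp_def)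

lemma unit_clamp_le_0 [simp]: "x \<le> 0 \<Longrightarrow> unit_clamp x = 0"
  by (simp add: unit_clamp_def)

lemma unit_clamp_ge_1 [simp]: "x \<ge> 1 \<Longrightarrow> unit_clamp x = 1"
  by (simp add: unit_clamp_def)

lemma unit_clamp_range [simp]: "0 \<le> unit_clamp x" "unit_clamp x \<le> 1"
  by (auto simp: unit_clamp_def)

lemma continuous_map_compose2:
  assumes "continuous_map Y Z g" "continuous_map X Y f"
  shows "continuous_map X Z (\<lambda>x. g (f x))"
  using continuous_map_compose[OF assms(2,1)] by (simp add: o_def)

lemma continuous_map_unit_clamp [continuous_intros]:
  assumes "continuous_map X euclideanreal p"
  shows "continuous_map X unit_interval (\<lambda>x. unit_clamp (p x))"
  unfolding continuous_map_in_subtopology unit_clamp_def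
  by (auto intro!: continuous_intros assms)

lemma continuous_map_from_unit_interval:
  "continuous_map X unit_interval p \<Longrightarrow> continuous_map X euclideanreal p"
  by (simp add: continuous_map_in_subtopology)

lemma continuous_map_fst_real [continuous_intros]:
  "continuous_map (prod_topology unit_interval X) euclideanreal fst"
  by (rule continuous_map_from_unit_interval[OF continuous_map_fst])

text \<open>
  The exponential law for paths. Evaluation is continuous because the interval is locally
  compact; conversely, the tube lemma for a compact set of times makes the adjoint map
  continuous for the compact-open topology.
\<close>

lemma continuous_map_path_space_iff:
  "continuous_map U (path_space Y) h \<longleftrightarrow>
     (\<forall>u\<in>topspace U. h u \<in> extensional {0..1}) \<and>
     continuous_map (prod_topology unit_interval U) Y (\<lambda>z. h (snd z) (fst z))"
  (is "?L \<longleftrightarrow> ?E \<and> ?R")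
proof (intro iffI conjI)
  assume L: ?L
  then have h: "h u \<in> extensional {0..1}" "continuous_map unit_interval Y (h u)" if "u \<in> topspace U" for u
    using continuous_map_funspace[OF L] that
    by (auto simp: path_space_def topspace_compact_open Pi_iff)
  then show ?E by blast
  show ?R
    unfolding continuous_map_def
  proof (intro conjI allI impI)
    show "(\<lambda>z. h (snd z) (fst z)) \<in> topspace (prod_topology unit_interval U) \<rightarrow> topspace Y"
      using h(2) by (auto simp: continuous_map_def Pi_iff)
  next
    fix V assume V: "openin Y V"
    let ?P = "{z \<in> topspace (prod_topology unit_interval U). h (snd z) (fst z) \<in> V}"
    have "\<exists>A B. openin unit_interval A \<and> openin U B \<and> s \<in> A \<and> u \<in> B \<and> A \<times> B \<subseteq> ?P"
      if "(s, u) \<in> ?P" for s u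
    proof -
      have su: "s \<in> {0..1}" "u \<in> topspace U" "h u s \<in> V" using that by auto
      have "openin unit_interval {r \<in> topspace unit_interval. h u r \<in> V}"
        using h(2)[OF su(2)] V by (simp only: continuous_map_def)
      then obtain W where W: "open W" "{r \<in> {0..1}. h u r \<in> V} = {0..1} \<inter> W"
        by (auto simp: openin_open)
      then obtain \<epsilon> where \<epsilon>: "\<epsilon> > 0" "cball s \<epsilon> \<subseteq> W"
        using su open_contains_cball[of W] by (metis (no_types, lifting) IntD2 mem_Collect_eq)
      \<comment> \<open>The path \<open>h u\<close> maps a compact neighbourhood \<open>?K\<close> of \<open>s\<close> into \<open>V\<close>, and so do all paths near it.\<close>
      let ?K = "cball s \<epsilon> \<inter> {0..1}" let ?A = "ball s \<epsilon> \<inter> {0..1}"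
      let ?N = "{g \<in> extensional (topspace unit_interval). continuous_map unit_interval Y g \<and> g ` ?K \<subseteq> V}"
      have K: "compactin unit_interval ?K"
        by (auto simp: compactin_subtopology compact_Int)
      have "openin (path_space Y) ?N"
        unfolding path_space_def compact_open_topology_def
        by (rule topology_generated_by_Basis) (use K V in blast)
      then have B: "openin U {v \<in> topspace U. h v \<in> ?N}"
        using L unfolding continuous_map_def by blast
      have "u \<in> {v \<in> topspace U. h v \<in> ?N}"
        using h[OF su(2)] su W \<epsilon> by auto
      moreover have "openin unit_interval ?A"
        by (metis inf_commute open_ball openin_open_Int)
      moreover have "?A \<times> {v \<in> topspace U. h v \<in> ?N} \<subseteq> ?P"
        by auto
      moreover have "s \<in> ?A" using su \<epsilon> by auto
      ultimately show ?thesis using B by blast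
    qed
    then show "openin (prod_topology unit_interval U) ?P"
      unfolding openin_prod_topology_alt by blast
  qed
next
  assume ER: "?E \<and> ?R"
  have paths: "continuous_map unit_interval Y (h u)" if "u \<in> topspace U" for u
  proof -
    have "continuous_map unit_interval (prod_topology unit_interval U) (\<lambda>s. (s, u))"
      using that by (intro continuous_intros) auto
    from continuous_map_compose2[OF conjunct2[OF ER] this] show ?thesis by simp
  qed
  show ?L
    unfolding path_space_def compact_open_topology_def
  proof (rule continuous_on_generated_topo)
    fix N assume "N \<in> {{g \<in> extensional (topspace unit_interval).
        continuous_map unit_interval Y g \<and> g ` K \<subseteq> V} |K V. compactin unit_interval K \<and> openin Y V}"
    then obtain K V where N: "N = {g \<in> extensional (topspace unit_interval).
        continuous_map unit_interval Y g \<and> g ` K \<subseteq> V}" "compactin unit_interval K" "openin Y V"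
      by blast
    let ?P = "{z \<in> topspace (prod_topology unit_interval U). h (snd z) (fst z) \<in> V}"
    have P: "openin (prod_topology unit_interval U) ?P"
      using ER N(3) unfolding continuous_map_def by blast
    have KI: "K \<subseteq> {0..1}" using compactin_subset_topspace[OF N(2)] by simp
    show "openin U (h -` N \<inter> topspace U)"
    proof (subst openin_subopen, intro ballI)
      fix u assume u: "u \<in> h -` N \<inter> topspace U"
      then have "K \<times> {u} \<subseteq> ?P" using KI N(1) by auto
      then obtain A B where
        "openin U B" "u \<in> B" "K \<subseteq> A" "A \<times> B \<subseteq> ?P"
        using tube_lemma_left[OF P N(2), of u] u by (elim IntE) blast
      moreover have "B \<subseteq> h -` N \<inter> topspace U"
      proof
        fix v assume v: "v \<in> B"
        then have "v \<in> topspace U" using \<open>openin U B\<close> openin_subset by blast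
        then show "v \<in> h -` N \<inter> topspace U"
          using paths ER v subsetD[OF \<open>A \<times> B \<subseteq> ?P\<close>, of "(_, v)"] \<open>K \<subseteq> A\<close> by (auto simp: N(1))
      qed
      ultimately show "\<exists>T. openin U T \<and> u \<in> T \<and> T \<subseteq> h -` N \<inter> topspace U" by blast
    qed
  next
    show "h ` topspace U \<subseteq> \<Union>{{g \<in> extensional (topspace unit_interval).
        continuous_map unit_interval Y g \<and> g ` K \<subseteq> V} |K V. compactin unit_interval K \<and> openin Y V}"
    proof (intro image_subsetI UnionI)
      fix u assume "u \<in> topspace U"
      then show "h u \<in> {g \<in> extensional (topspace unit_interval).
          continuous_map unit_interval Y g \<and> g ` {} \<subseteq> {}}"
        using paths ER by simp
    qed (intro CollectI exI[of _ "{}"], simp)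
  qed
qed

lemma topspace_path_space:
  "topspace (path_space Y) = {\<gamma> \<in> extensional {0..1}. continuous_map unit_interval Y \<gamma>}"
  by (simp add: path_space_def topspace_compact_open)

lemma continuous_map_curry_path:
  assumes "continuous_map (prod_topology unit_interval U) Y H"
  shows "continuous_map U (path_space Y) (\<lambda>u. \<lambda>s\<in>{0..1}. H (s, u))"
  unfolding continuous_map_path_space_iff
  by (auto intro!: continuous_map_eq[OF assms])

lemma continuous_map_eval_path:
  assumes "continuous_map U (path_space Y) h" "continuous_map U unit_interval p"
  shows "continuous_map U Y (\<lambda>u. h u (p u))"
proof -
  have "continuous_map U (prod_topology unit_interval U) (\<lambda>u. (p u, u))"
    by (intro continuous_intros assms)
  from continuous_map_compose2[OF _ this] assms(1) show ?thesis
    unfolding continuous_map_path_space_iff by fastforce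
qed

section \<open>Homotopies\<close>

lemma homotopic_maps_compose_left:
  assumes "homotopic_maps X Y f f'" "continuous_map Y Z k"
  shows "homotopic_maps X Z (\<lambda>x. k (f x)) (\<lambda>x. k (f' x))"
  using homotopic_with_compose_continuous_map_left[OF assms, where q = "\<lambda>_. True"] by (simp add: o_def)

lemma homotopic_maps_compose_right:
  assumes "homotopic_maps Y Z f f'" "continuous_map X Y k"
  shows "homotopic_maps X Z (\<lambda>x. f (k x)) (\<lambda>x. f' (k x))"
  using homotopic_with_compose_continuous_map_right[OF assms, where q = "\<lambda>_. True"] by (simp add: o_def)

lemma homotopic_maps_iff:
  "homotopic_maps X Y f g \<longleftrightarrow>
     (\<exists>h. continuous_map (prod_topology unit_interval X) Y h \<and>
          (\<forall>x\<in>topspace X. h (0, x) = f x \<and> h (1, x) = g x))"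
  by (subst homotopic_with) auto

lemma homotopic_maps_pair:
  assumes "homotopic_maps X Y f f'" "homotopic_maps X Z g g'"
  shows "homotopic_maps X (prod_topology Y Z) (\<lambda>x. (f x, g x)) (\<lambda>x. (f' x, g' x))"
proof -
  obtain h k where "continuous_map (prod_topology unit_interval X) Y h"
    "\<forall>x\<in>topspace X. h (0, x) = f x \<and> h (1, x) = f' x"
    "continuous_map (prod_topology unit_interval X) Z k"
    "\<forall>x\<in>topspace X. k (0, x) = g x \<and> k (1, x) = g' x"
    using assms unfolding homotopic_maps_iff by blast
  then show ?thesis
    unfolding homotopic_maps_iff
    by (intro exI[of _ "\<lambda>z. (h z, k z)"]) (auto intro: continuous_intros)
qed

lemma homotopic_maps_continuous:
  assumes "homotopic_maps X Y f g"
  shows "continuous_map X Y f" "continuous_map X Y g"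
  using homotopic_with_imp_continuous_maps[OF assms] by auto

lemma homotopic_maps_const:
  assumes "path_connected_space Y" "a \<in> topspace Y" "b \<in> topspace Y"
  shows "homotopic_maps X Y (\<lambda>_. a) (\<lambda>_. b)"
proof -
  obtain p where p: "pathin Y p" "p 0 = a" "p 1 = b"
    using assms unfolding path_connected_space_def by blast
  show ?thesis
    unfolding homotopic_maps_iff
    using p by (intro exI[of _ "\<lambda>z. p (fst z)"])
      (auto simp: pathin_def intro!: continuous_map_compose2[OF _ continuous_map_fst])
qed

text \<open>
  A path through prescribed points at prescribed times is a concatenation of paths between
  consecutive points, so a family of such paths is a chain of homotopies.
\<close>

lemma homotopic_iff_path_family:
  assumes "m \<ge> 1" "t 1 = 0" "t m = 1" "strict_mono_on {1..m} t"
    and cont: "\<And>i. i \<in> {1..m} \<Longrightarrow> continuous_map U G (f i)"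
  shows "(\<forall>i\<in>{1..<m}. homotopic_maps U G (f i) (f (Suc i))) \<longleftrightarrow>
    (\<exists>h. continuous_map U (path_space G) h \<and> (\<forall>u\<in>topspace U. \<forall>i\<in>{1..m}. h u (t i) = f i u))"
    (is "?L \<longleftrightarrow> ?R")
proof
  assume L: ?L
  have mono: "t i < t j" if "i \<in> {1..m}" "j \<in> {1..m}" "i < j" for i j
    using assms(4) that by (simp add: strict_mono_onD)
  \<comment> \<open>After the last prescribed time the partial path stays constant.\<close>
  have "\<exists>H. continuous_map (prod_topology unit_interval U) G H \<and>
      (\<forall>u\<in>topspace U. (\<forall>i\<in>{1..k}. H (t i, u) = f i u) \<and> (\<forall>s\<in>{t k..1}. H (s, u) = f k u))"
    if "1 \<le> k" "k \<le> m" for k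
    using that
  proof (induction k rule: nat_induct_at_least)
    case base
    then show ?case
      using cont[of 1] assms(1)
      by (intro exI[of _ "\<lambda>z. f 1 (snd z)"]) (auto intro: continuous_map_compose2[OF _ continuous_map_snd])
  next
    case (Suc k)
    then obtain H where H: "continuous_map (prod_topology unit_interval U) G H"
      "\<And>u i. u \<in> topspace U \<Longrightarrow> i \<in> {1..k} \<Longrightarrow> H (t i, u) = f i u"
      "\<And>u s. u \<in> topspace U \<Longrightarrow> s \<in> {t k..1} \<Longrightarrow> H (s, u) = f k u"
      by (metis Suc_leD)
    from L Suc obtain h where h: "continuous_map (prod_topology unit_interval U) G h"
      "\<And>x. x \<in> topspace U \<Longrightarrow> h (0, x) = f k x \<and> h (1, x) = f (Suc k) x"
      unfolding homotopic_maps_iff by fastforce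
    have tk: "t k < t (Suc k)" using Suc mono by auto
    have tk': "t k \<le> 1" using assms(3) mono[of k m] Suc by (cases "k = m") auto
    let ?v = "\<lambda>z. unit_clamp ((fst z - t k) / (t (Suc k) - t k))"
    let ?H = "\<lambda>z. if fst z \<le> t k then H z else h (?v z, snd z)"
    have "continuous_map (prod_topology unit_interval U) G ?H"
    proof (rule continuous_map_cases_le)
      show "continuous_map (subtopology (prod_topology unit_interval U)
              {x \<in> topspace (prod_topology unit_interval U). t k \<le> fst x}) G (\<lambda>z. h (?v z, snd z))"
        using tk by (intro continuous_map_from_subtopology continuous_map_compose2[OF h(1)] continuous_intros) auto
      fix z assume "z \<in> topspace (prod_topology unit_interval U)" "fst z = t k"
      then show "H z = h (?v z, snd z)"
        using H(3)[of "snd z" "t k"] h(2)[of "snd z"] tk' by (cases z) auto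
    qed (auto intro!: continuous_intros continuous_map_from_subtopology H(1))
    moreover have "?H (t i, u) = f i u" if "u \<in> topspace U" "i \<in> {1..Suc k}" for u i
    proof (cases "i = Suc k")
      case True
      then show ?thesis using tk h(2)[OF that(1)] by auto
    next
      case False
      then have "i \<in> {1..k}" using that by auto
      moreover have "t i \<le> t k" using calculation mono[of i k] Suc by (cases "i = k") auto
      ultimately have "i \<in> {1..k}" "t i \<le> t k" by auto
      then show ?thesis using H(2) that by auto
    qed
    moreover have "?H (s, u) = f (Suc k) u" if "u \<in> topspace U" "s \<in> {t (Suc k)..1}" for u s
    proof -
      have "(s - t k) / (t (Suc k) - t k) \<ge> 1" using that tk by (simp add: field_simps)
      then show ?thesis using that tk h(2) by auto
    qed
    ultimately show ?case by blast
  qed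
  from this[of m] obtain H where H: "continuous_map (prod_topology unit_interval U) G H"
      "\<And>u i. u \<in> topspace U \<Longrightarrow> i \<in> {1..m} \<Longrightarrow> H (t i, u) = f i u"
    using assms(1) by blast
  have "t i \<in> {0..1}" if "i \<in> {1..m}" for i
    using mono[of 1 i] mono[of i m] that assms by (cases "i = 1"; cases "i = m") auto
  then show ?R
    using H by (intro exI[of _ "\<lambda>u. \<lambda>s\<in>{0..1}. H (s, u)"]) (auto intro: continuous_map_curry_path)
next
  assume ?R
  then obtain h where h: "continuous_map U (path_space G) h"
    "\<And>u i. u \<in> topspace U \<Longrightarrow> i \<in> {1..m} \<Longrightarrow> h u (t i) = f i u" by blast
  have t: "t i \<in> {0..1}" if "i \<in> {1..m}" for i
    using strict_mono_onD[OF assms(4), of 1 i] strict_mono_onD[OF assms(4), of i m] that assms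
    by (cases "i = 1"; cases "i = m") auto
  show ?L
  proof
    fix i assume i: "i \<in> {1..<m}"
    let ?p = "\<lambda>s. unit_clamp ((1 - s) * t i + s * t (Suc i))"
    let ?I = "prod_topology unit_interval U"
    have "continuous_map ?I (path_space G) (\<lambda>z. h (snd z))"
      by (rule continuous_map_compose2[OF h(1) continuous_map_snd])
    moreover have "continuous_map ?I unit_interval (\<lambda>z. ?p (fst z))"
      by (intro continuous_intros)
    ultimately have "continuous_map ?I G (\<lambda>z. h (snd z) (?p (fst z)))"
      by (rule continuous_map_eval_path)
    then show "homotopic_maps U G (f i) (f (Suc i))"
      unfolding homotopic_maps_iff using t[of i] t[of "Suc i"] h(2) i
      by (intro exI[of _ "\<lambda>z. h (snd z) (?p (fst z))"]) auto
  qed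
qed

section \<open>Invariance under maps over the base\<close>

text \<open>
  Pushing measures forward along a map over the base is what makes the distributional
  sectional category monotone; it is continuous for both topologies on measures.
\<close>

lemma dsecat_wrt_mono:
  assumes push: "\<And>n. continuous_map (T (n + 1)) (T' (n + 1)) (map_pmf \<alpha>)"
    and supp: "\<And>n \<nu>. \<nu> \<in> topspace (T (n + 1)) \<Longrightarrow> set_pmf \<nu> \<subseteq> E"
    and over: "\<And>z. z \<in> E \<Longrightarrow> p' (\<alpha> z) = p z"
  shows "dsecat_wrt T' B p' \<le> dsecat_wrt T B p"
  unfolding dsecat_wrt_def
proof (rule Inf_superset_mono, clarify)
  fix n s
  assume s: "continuous_map B (fibre_measures T p (n + 1)) s"
    "\<forall>b\<in>topspace B. the_elem (p ` set_pmf (s b)) = b"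
  have s': "continuous_map B (T (n + 1)) s"
    "\<And>b. b \<in> topspace B \<Longrightarrow> \<exists>c. \<forall>z\<in>set_pmf (s b). p z = c"
    using s(1) by (auto simp: fibre_measures_def continuous_map_in_subtopology Pi_iff)
  have E: "set_pmf (s b) \<subseteq> E" if "b \<in> topspace B" for b
    using supp s'(1) that by (auto simp: continuous_map_def Pi_iff)
  let ?s = "\<lambda>b. map_pmf \<alpha> (s b)"
  have img: "p' ` set_pmf (?s b) = p ` set_pmf (s b)" if "b \<in> topspace B" for b
    using E[OF that] over by (force simp: image_image)
  have "continuous_map B (fibre_measures T' p' (n + 1)) ?s"
    unfolding fibre_measures_def
  proof (intro continuous_map_into_subtopology continuous_map_compose2[OF push s'(1)] Pi_I CollectI)
    fix b assume b: "b \<in> topspace B"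
    then obtain c where "\<forall>z\<in>set_pmf (s b). p z = c" using s'(2) by blast
    then show "\<exists>c. \<forall>z\<in>set_pmf (?s b). p' z = c"
      using E[OF b] over by (intro exI[of _ c]) auto
  qed
  moreover have "\<forall>b\<in>topspace B. the_elem (p' ` set_pmf (?s b)) = b"
    using s(2) img by simp
  ultimately show "\<exists>na. enat n = enat na \<and> (\<exists>s. continuous_map B (fibre_measures T' p' (na + 1)) s \<and>
      (\<forall>b\<in>topspace B. the_elem (p' ` set_pmf (s b)) = b))" by blast
qed

text \<open>
  Measures carry the quotient topology along the barycenter, and the barycenter commutes with
  pushing forward the points while keeping the weights.
\<close>

lemma continuous_map_join_measures:
  assumes "continuous_map E E' \<alpha>" "k \<ge> 1"
  shows "continuous_map (join_measures E k) (join_measures E' k) (map_pmf \<alpha>)"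
proof -
  let ?S = "subtopology (powertop_real UNIV) (standard_simplex (k - 1))"
  let ?P = "\<lambda>E. prod_topology ?S (product_topology (\<lambda>_. E) {..<k})"
  let ?f = "\<lambda>p. (fst p, \<lambda>i\<in>{..<k}. \<alpha> (snd p i))"
  have proj: "continuous_map (?P E) E (\<lambda>p. snd p i)" if "i < k" for i
    using that by (intro continuous_map_compose2[OF continuous_map_product_projection continuous_map_snd]) simp
  have "continuous_map (?P E) (?P E') ?f"
  proof (intro continuous_map_pairedI continuous_map_fst)
    show "continuous_map (?P E) (product_topology (\<lambda>_. E') {..<k}) (\<lambda>p. \<lambda>i\<in>{..<k}. \<alpha> (snd p i))"
      unfolding continuous_map_componentwise
      using continuous_map_compose2[OF assms(1) proj] by (simp add: image_subset_iff)
  qed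
  then have "continuous_map (?P E) (join_measures E' k) (\<lambda>p. barycenter (?f p))"
    unfolding join_measures_def
    by (rule continuous_map_compose2[OF quotient_imp_continuous_map[OF quotient_map_quotient_topology]])
  moreover have "barycenter (?f p) = (map_pmf \<alpha> \<circ> barycenter) p" if p: "p \<in> topspace (?P E)" for p
  proof -
    obtain w x where wx: "p = (w, x)" by (cases p)
    have w: "w \<in> standard_simplex (k - 1)"
      using p wx by (simp add: topspace_standard_simplex)
    have supp: "set_pmf (embed_pmf w) \<subseteq> {..<k}"
    proof -
      have nn: "\<And>i. 0 \<le> w i" "\<And>i. i \<ge> k \<Longrightarrow> w i = 0" "(\<Sum>i<k. w i) = 1"
        using w assms(2) lessThan_Suc_atMost[of "k - 1"] by (auto simp: standard_simplex_def)
      have "(\<integral>\<^sup>+ i. ennreal (w i) \<partial>count_space UNIV) = (\<Sum>i<k. ennreal (w i))"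
        by (rule nn_integral_count_space'[of "{..<k}"]) (auto simp: nn not_less)
      also have "\<dots> = 1" by (simp add: nn sum_ennreal)
      finally have "set_pmf (embed_pmf w) = {i. w i \<noteq> 0}"
        using nn(1) by (intro set_embed_pmf) auto
      then show ?thesis using nn(2) not_less by auto
    qed
    have "map_pmf (\<lambda>i\<in>{..<k}. \<alpha> (x i)) (embed_pmf w) = map_pmf (\<lambda>i. \<alpha> (x i)) (embed_pmf w)"
      using supp by (intro map_pmf_cong) auto
    then show ?thesis by (simp add: wx barycenter_def pmf.map_comp o_def)
  qed
  ultimately have "continuous_map (?P E) (join_measures E' k) (map_pmf \<alpha> \<circ> barycenter)"
    by (rule continuous_map_eq)
  then show ?thesis
    using continuous_compose_quotient_map[OF quotient_map_quotient_topology]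
    unfolding join_measures_def[of E] by blast
qed

lemma dsecat_mono:
  assumes "continuous_map E E' \<alpha>" "\<And>z. z \<in> topspace E \<Longrightarrow> p' (\<alpha> z) = p z"
  shows "dsecat E' B p' \<le> dsecat E B p"
  unfolding dsecat_def
proof (rule dsecat_wrt_mono[where \<alpha> = \<alpha> and E = "topspace E"])
  show "continuous_map (join_measures E (n + 1)) (join_measures E' (n + 1)) (map_pmf \<alpha>)" for n
    by (rule continuous_map_join_measures[OF assms(1)]) simp
  show "set_pmf \<nu> \<subseteq> topspace E" if "\<nu> \<in> topspace (join_measures E (n + 1))" for n \<nu>
    using that by (simp add: topspace_join_measures fin_measures_def)
qed (rule assms(2))

text \<open>
  Near a finitely supported measure \<open>\<nu>\<close> only the behaviour of \<open>\<alpha>\<close> near the support matters, and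
  there one modulus of continuity works for all points. Both inequalities for a set \<open>A\<close> come
  from the closeness of \<open>\<nu>\<close> and \<open>\<rho>\<close> on finite, hence Borel, sets of support points: those
  mapped into \<open>A\<close> for the first one, those not mapped into the neighbourhood of \<open>A\<close> for the
  second one, after taking complements.
\<close>

lemma LP_close_map_pmf:
  assumes fin: "finite (set_pmf \<nu>)" and sub: "set_pmf \<nu> \<subseteq> mspace M" "set_pmf \<rho> \<subseteq> mspace M"
    and \<alpha>: "\<alpha> ` mspace M \<subseteq> mspace M'"
    and mod: "\<And>x y. x \<in> set_pmf \<nu> \<Longrightarrow> y \<in> mspace M \<Longrightarrow> mdist M x y < r \<Longrightarrow> mdist M' (\<alpha> x) (\<alpha> y) < q"
    and r: "r \<le> q" and close: "LP_close M \<nu> \<rho> r"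
  shows "LP_close M' (map_pmf \<alpha> \<nu>) (map_pmf \<alpha> \<rho>) q"
  unfolding LP_close_def
proof (intro ballI)
  fix A assume "A \<in> sigma_sets (mspace M') {U. openin (mtopology_of M') U}"
  then have A: "A \<subseteq> mspace M'"
    by (rule sigma_sets_into_sp[rotated]) (use openin_subset in fastforce)
  have ineq: "measure_pmf.prob \<nu> F \<le> measure_pmf.prob \<rho> (metric_nbhd M F r) + r"
    if F: "F \<subseteq> set_pmf \<nu>" for F
  proof -
    have "finite F" "F \<subseteq> mspace M" using F fin sub finite_subset by blast+
    then have "closedin (mtopology_of M) F"
      using Metric_space.Hausdorff_space_mtopology[OF Metric_space_mspace_mdist, of M]
      by (intro closedin_Hausdorff_finite) (simp_all add: mtopology_of_def Metric_space.topspace_mtopology[OF Metric_space_mspace_mdist])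
    then have "mspace M - (mspace M - F) \<in> sigma_sets (mspace M) {U. openin (mtopology_of M) U}"
      by (intro sigma_sets.Compl sigma_sets.Basic) (auto simp: closedin_def)
    moreover have "mspace M - (mspace M - F) = F" using \<open>F \<subseteq> mspace M\<close> by auto
    ultimately show ?thesis using close unfolding LP_close_def by auto
  qed
  let ?A = "\<alpha> -` A" and ?Aq = "\<alpha> -` metric_nbhd M' A q"
  have \<nu>: "measure_pmf.prob \<nu> (set_pmf \<nu> \<inter> S) = measure_pmf.prob \<nu> S" for S
    by (metis Int_commute measure_Int_set_pmf)
  have \<rho>: "measure_pmf.prob \<rho> (S \<inter> set_pmf \<rho>) = measure_pmf.prob \<rho> S" for S
    by (rule measure_Int_set_pmf)
  have "measure_pmf.prob \<nu> ?A \<le> measure_pmf.prob \<rho> ?Aq + q"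
  proof -
    have "metric_nbhd M (set_pmf \<nu> \<inter> ?A) r \<subseteq> ?Aq"
      using mod \<alpha> by (force simp: metric_nbhd_def)
    then have "measure_pmf.prob \<rho> (metric_nbhd M (set_pmf \<nu> \<inter> ?A) r) \<le> measure_pmf.prob \<rho> ?Aq"
      by (intro measure_pmf.finite_measure_mono) auto
    then show ?thesis using ineq[of "set_pmf \<nu> \<inter> ?A"] r by (simp add: \<nu>)
  qed
  moreover have "measure_pmf.prob \<rho> ?A \<le> measure_pmf.prob \<nu> ?Aq + q"
  proof -
    let ?C = "set_pmf \<nu> \<inter> - ?Aq"
    have "metric_nbhd M ?C r \<inter> ?A = {}"
    proof (rule ccontr)
      assume "metric_nbhd M ?C r \<inter> ?A \<noteq> {}"
      then obtain x y where xy: "x \<in> set_pmf \<nu>" "\<alpha> x \<notin> metric_nbhd M' A q" "y \<in> mspace M"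
        "mdist M x y < r" "\<alpha> y \<in> A"
        by (auto simp: metric_nbhd_def)
      then have "mdist M' (\<alpha> y) (\<alpha> x) < q"
        using mod[of x y] by (simp add: mdist_commute)
      then show False using xy sub \<alpha> unfolding metric_nbhd_def by blast
    qed
    then have "metric_nbhd M ?C r \<subseteq> - ?A" by auto
    then have "measure_pmf.prob \<rho> (metric_nbhd M ?C r) \<le> measure_pmf.prob \<rho> (- ?A)"
      by (intro measure_pmf.finite_measure_mono) auto
    moreover have "measure_pmf.prob \<rho> (- ?A) = 1 - measure_pmf.prob \<rho> ?A"
      using measure_pmf.prob_compl[of ?A \<rho>] by (simp add: Compl_eq_Diff_UNIV)
    moreover have "measure_pmf.prob \<nu> ?C = 1 - measure_pmf.prob \<nu> ?Aq"
      using measure_pmf.prob_compl[of ?Aq \<nu>] by (simp add: \<nu> Compl_eq_Diff_UNIV)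
    ultimately show ?thesis using ineq[of ?C] r by simp
  qed
  ultimately show "measure_pmf.prob (map_pmf \<alpha> \<nu>) A \<le> measure_pmf.prob (map_pmf \<alpha> \<rho>) (metric_nbhd M' A q) + q \<and>
      measure_pmf.prob (map_pmf \<alpha> \<rho>) A \<le> measure_pmf.prob (map_pmf \<alpha> \<nu>) (metric_nbhd M' A q) + q"
    by simp
qed

lemma continuous_map_LP_measures:
  assumes \<alpha>: "continuous_map (mtopology_of M) (mtopology_of M') \<alpha>"
  shows "continuous_map (LP_measures M k) (LP_measures M' k) (map_pmf \<alpha>)"
proof -
  interpret A: Metric_space "fin_measures k (mspace M)" "LP_dist M" by (rule Metric_space_LP_dist)
  interpret B: Metric_space "fin_measures k (mspace M')" "LP_dist M'" by (rule Metric_space_LP_dist)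
  have \<alpha>M: "\<alpha> ` mspace M \<subseteq> mspace M'"
    using continuous_map_image_subset_topspace[OF \<alpha>] by simp
  have map: "map_pmf \<alpha> \<nu> \<in> fin_measures k (mspace M')" if "\<nu> \<in> fin_measures k (mspace M)" for \<nu>
    using that \<alpha>M card_image_le[of "set_pmf \<nu>" \<alpha>] by (auto simp: fin_measures_def)
  show ?thesis
    unfolding LP_measures_def B.continuous_map_to_metric
  proof (intro ballI allI impI)
    fix \<nu> and \<epsilon> :: real assume \<nu>: "\<nu> \<in> topspace A.mtopology" and "\<epsilon> > 0"
    then have \<nu>': "\<nu> \<in> fin_measures k (mspace M)" by simp
    then have fin: "finite (set_pmf \<nu>)" "set_pmf \<nu> \<subseteq> mspace M" by (auto simp: fin_measures_def)
    have "\<exists>\<delta>>0. \<forall>y\<in>mspace M. mdist M x y < \<delta> \<longrightarrow> mdist M' (\<alpha> x) (\<alpha> y) < \<epsilon>/2" if "x \<in> set_pmf \<nu>" for x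
    proof -
      interpret m: Metric_space "mspace M" "mdist M" by (rule Metric_space_mspace_mdist)
      interpret m': Metric_space "mspace M'" "mdist M'" by (rule Metric_space_mspace_mdist)
      have x: "x \<in> mspace M" using fin that by blast
      obtain U where U: "openin m.mtopology U" "x \<in> U" "\<forall>y\<in>U. \<alpha> y \<in> m'.mball (\<alpha> x) (\<epsilon>/2)"
        using \<alpha> x \<open>\<epsilon> > 0\<close> m'.continuous_map_to_metric[of m.mtopology \<alpha>]
        unfolding mtopology_of_def by (metis half_gt_zero m.topspace_mtopology)
      then obtain \<delta> where "\<delta> > 0" "m.mball x \<delta> \<subseteq> U"
        unfolding m.openin_mtopology by blast
      then show ?thesis using U(3) x by (intro exI[of _ \<delta>]) auto
    qed
    then obtain \<delta> where \<delta>: "\<And>x. x \<in> set_pmf \<nu> \<Longrightarrow> \<delta> x > 0"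
      "\<And>x y. x \<in> set_pmf \<nu> \<Longrightarrow> y \<in> mspace M \<Longrightarrow> mdist M x y < \<delta> x \<Longrightarrow> mdist M' (\<alpha> x) (\<alpha> y) < \<epsilon>/2"
      by metis
    define d where "d = Min (insert (\<epsilon>/2) (\<delta> ` set_pmf \<nu>))"
    have d: "d > 0" "d \<le> \<epsilon>/2" "\<And>x. x \<in> set_pmf \<nu> \<Longrightarrow> d \<le> \<delta> x"
    proof -
      show "d > 0" unfolding d_def using fin(1) \<delta>(1) \<open>\<epsilon> > 0\<close> by (subst Min_gr_iff) auto
      show "d \<le> \<epsilon>/2" unfolding d_def using fin(1) by (intro Min_le) auto
      show "d \<le> \<delta> x" if "x \<in> set_pmf \<nu>" for x
        unfolding d_def using fin(1) that by (intro Min_le) auto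
    qed
    have "map_pmf \<alpha> \<rho> \<in> B.mball (map_pmf \<alpha> \<nu>) \<epsilon>" if "\<rho> \<in> A.mball \<nu> d" for \<rho>
    proof -
      have \<rho>: "\<rho> \<in> fin_measures k (mspace M)" "LP_dist M \<nu> \<rho> < d" using that by auto
      then obtain r where r: "0 < r" "r < d" "LP_close M \<nu> \<rho> r"
        unfolding LP_dist_less_iff by blast
      have "LP_close M' (map_pmf \<alpha> \<nu>) (map_pmf \<alpha> \<rho>) (\<epsilon>/2)"
      proof (rule LP_close_map_pmf[OF fin _ \<alpha>M _ _ r(3)])
        show "set_pmf \<rho> \<subseteq> mspace M" using \<rho> by (simp add: fin_measures_def)
        show "r \<le> \<epsilon>/2" using r d by linarith
        show "mdist M' (\<alpha> x) (\<alpha> y) < \<epsilon>/2"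
          if "x \<in> set_pmf \<nu>" "y \<in> mspace M" "mdist M x y < r" for x y
          using \<delta>(2)[OF that(1,2)] that(3) r d(3)[OF that(1)] by linarith
      qed
      then have "LP_dist M' (map_pmf \<alpha> \<nu>) (map_pmf \<alpha> \<rho>) < \<epsilon>"
        unfolding LP_dist_less_iff using \<open>\<epsilon> > 0\<close> by (intro exI[of _ "\<epsilon>/2"]) auto
      then show ?thesis using map \<nu>' \<rho> by simp
    qed
    then show "\<exists>U. openin A.mtopology U \<and> \<nu> \<in> U \<and> (\<forall>\<rho>\<in>U. map_pmf \<alpha> \<rho> \<in> B.mball (map_pmf \<alpha> \<nu>) \<epsilon>)"
      using \<nu>' d(1) by (intro exI[of _ "A.mball \<nu> d"]) auto
  qed
qed

lemma dsecat_LP_mono: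
  assumes "continuous_map (mtopology_of M) (mtopology_of M') \<alpha>"
    and "\<And>z. z \<in> topspace (mtopology_of M) \<Longrightarrow> p' (\<alpha> z) = p z"
  shows "dsecat_LP M' B p' \<le> dsecat_LP M B p"
  unfolding dsecat_LP_def
proof (rule dsecat_wrt_mono[where \<alpha> = \<alpha> and E = "topspace (mtopology_of M)"])
  show "set_pmf \<nu> \<subseteq> topspace (mtopology_of M)" if "\<nu> \<in> topspace (LP_measures M (n + 1))" for n \<nu>
  proof -
    have "\<nu> \<in> fin_measures (n + 1) (mspace M)"
      using that unfolding LP_measures_def Metric_space.topspace_mtopology[OF Metric_space_LP_dist] .
    then show ?thesis by (simp add: fin_measures_def)
  qed
qed (use continuous_map_LP_measures[OF assms(1)] assms(2) in auto)

section \<open>Sections over CW complexes\<close>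

definition disc_top :: "nat \<Rightarrow> (nat \<Rightarrow> real) topology" where
  "disc_top n = subtopology (Euclidean_space n) (closed_disc n)"

definition disc_boundary :: "nat \<Rightarrow> (nat \<Rightarrow> real) set" where
  "disc_boundary n = closed_disc n - open_disc n"

lemma topspace_disc_top [simp]: "topspace (disc_top n) = closed_disc n"
  by (auto simp: disc_top_def closed_disc_def)

lemma open_disc_subset: "open_disc n \<subseteq> closed_disc n"
  by (auto simp: open_disc_def closed_disc_def)

lemma compact_space_disc_top: "compact_space (disc_top n)"
proof -
  have eu: "Euclidean_space n = top_of_set {x. \<forall>i\<ge>n. x i = 0}"
    by (simp add: Euclidean_space_def euclidean_product_topology)
  have "disc_top n = top_of_set (closed_disc n)"
    unfolding disc_top_def eu subtopology_subtopology
    by (rule arg_cong[of _ _ top_of_set]) (auto simp: closed_disc_def topspace_Euclidean_space)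
  moreover have "compact (closed_disc n)"
  proof -
    let ?C = "PiE UNIV (\<lambda>i::nat. if i < n then {-1..1::real} else {0})"
    have "compactin (powertop_real UNIV) ?C"
      by (subst compactin_PiE) auto
    then have "compact ?C"
      by (simp add: euclidean_product_topology)
    moreover have "closed {x :: nat \<Rightarrow> real. (\<Sum>i<n. (x i)\<^sup>2) \<le> 1}"
      by (intro closed_Collect_le continuous_intros continuous_on_coordinatewise_then_product
          continuous_on_product_coordinates)
    ultimately have "compact (?C \<inter> {x. (\<Sum>i<n. (x i)\<^sup>2) \<le> 1})"
      by (rule compact_Int_closed)
    moreover have "?C \<inter> {x. (\<Sum>i<n. (x i)\<^sup>2) \<le> 1} = closed_disc n"
    proof -
      have "\<bar>x i\<bar> \<le> 1" if "(\<Sum>i<n. (x i)\<^sup>2) \<le> 1" "i < n" for x :: "nat \<Rightarrow> real" and i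
      proof -
        have "(x i)\<^sup>2 \<le> (\<Sum>i<n. (x i)\<^sup>2)"
          using that by (intro member_le_sum) auto
        then show ?thesis using that abs_le_square_iff[of "x i" 1] by simp
      qed
      then show ?thesis
        by (intro equalityI subsetI)
          (auto simp: closed_disc_def topspace_Euclidean_space PiE_iff abs_le_iff not_less
            minus_le_iff split: if_splits)
    qed
    ultimately show ?thesis by simp
  qed
  ultimately show ?thesis by (simp add: compact_space_subtopology)
qed

lemma CW_structureD:
  assumes "CW_structure K C"
  shows "Hausdorff_space K"
    and "(n, \<phi>) \<in> C \<Longrightarrow> continuous_map (disc_top n) K \<phi>"
    and "(n, \<phi>) \<in> C \<Longrightarrow> inj_on \<phi> (open_disc n)"
    and "(n, \<phi>) \<in> C \<Longrightarrow> (k, \<psi>) \<in> C \<Longrightarrow> (n, \<phi>) \<noteq> (k, \<psi>) \<Longrightarrow> \<phi> ` open_disc n \<inter> \<psi> ` open_disc k = {}"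
    and "(\<Union>(n, \<phi>) \<in> C. \<phi> ` open_disc n) = topspace K"
    and "(n, \<phi>) \<in> C \<Longrightarrow> \<exists>C'. C' \<subseteq> C \<and> finite C' \<and> (\<forall>(k, \<psi>) \<in> C'. k < n) \<and>
           \<phi> ` disc_boundary n \<subseteq> (\<Union>(k, \<psi>) \<in> C'. \<psi> ` open_disc k)"
    and "A \<subseteq> topspace K \<Longrightarrow>
      (\<And>n \<phi>. (n, \<phi>) \<in> C \<Longrightarrow> closedin (disc_top n) {x \<in> closed_disc n. \<phi> x \<in> A}) \<Longrightarrow> closedin K A"
proof -
  note D = assms[unfolded CW_structure_def, folded disc_top_def disc_boundary_def]
  note D1 = conjunct1[OF D] note R1 = conjunct2[OF D]
  note D2 = conjunct1[OF R1] note R2 = conjunct2[OF R1]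
  note D3 = conjunct1[OF R2] note R3 = conjunct2[OF R2]
  note D4 = conjunct1[OF R3] note R4 = conjunct2[OF R3]
  note D5 = conjunct1[OF R4] and D6 = conjunct2[OF R4]
  show "Hausdorff_space K" by (rule D1)
  show "continuous_map (disc_top n) K \<phi>" if "(n, \<phi>) \<in> C" for n \<phi>
    using bspec[OF D2 that] by simp
  show "(\<Union>(n, \<phi>) \<in> C. \<phi> ` open_disc n) = topspace K" by (rule D4)
  show "inj_on \<phi> (open_disc n)" if "(n, \<phi>) \<in> C" for n \<phi>
  proof -
    have "embedding_map (subtopology (Euclidean_space n) (open_disc n)) K \<phi>"
      using bspec[OF D2 that] by simp
    then have "inj_on \<phi> (topspace (subtopology (Euclidean_space n) (open_disc n)))"
      unfolding embedding_map_def homeomorphic_eq_everything_map by blast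
    moreover have "topspace (subtopology (Euclidean_space n) (open_disc n)) = open_disc n"
      by (auto simp: open_disc_def)
    ultimately show ?thesis by simp
  qed
  show "\<phi> ` open_disc n \<inter> \<psi> ` open_disc k = {}"
    if "(n, \<phi>) \<in> C" "(k, \<psi>) \<in> C" "(n, \<phi>) \<noteq> (k, \<psi>)" for n \<phi> k \<psi>
    using pairwiseD[OF D3 that] by (simp add: disjnt_def)
  show "\<exists>C'. C' \<subseteq> C \<and> finite C' \<and> (\<forall>(k, \<psi>) \<in> C'. k < n) \<and>
           \<phi> ` disc_boundary n \<subseteq> (\<Union>(k, \<psi>) \<in> C'. \<psi> ` open_disc k)" if "(n, \<phi>) \<in> C" for n \<phi>
    using bspec[OF D5 that] by (simp only: prod.case)
  show "closedin K A" if A: "A \<subseteq> topspace K"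
      "\<And>n \<phi>. (n, \<phi>) \<in> C \<Longrightarrow> closedin (disc_top n) {x \<in> closed_disc n. \<phi> x \<in> A}" for A
    using spec[OF D6, of A] A by auto
qed

text \<open>
  A characteristic map is a quotient map onto its closed cell, by compactness, and closed cells
  are closed; so continuity on a finite union of closed cells can be tested on the discs. By
  closure-finiteness the boundary of a cell lies in such a union, which is all that an
  induction over the skeleta needs to know about their topology.
\<close>

lemma continuous_map_finite_closed_cells:
  assumes CW: "CW_structure K C" and C': "C' \<subseteq> C" "finite C'"
    and s: "\<And>n \<phi>. (n, \<phi>) \<in> C' \<Longrightarrow> continuous_map (disc_top n) S (s \<circ> \<phi>)"
  shows "continuous_map (subtopology K (\<Union>(n, \<phi>) \<in> C'. \<phi> ` closed_disc n)) S s"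
proof (rule pasting_lemma_closed[where T = "\<lambda>(n, \<phi>). \<phi> ` closed_disc n" and I = C' and f = "\<lambda>_. s"])
  let ?X = "subtopology K (\<Union>(n, \<phi>) \<in> C'. \<phi> ` closed_disc n)"
  note cont = CW_structureD(2)[OF CW]
  have img: "\<phi> ` closed_disc n \<subseteq> topspace K" if "(n, \<phi>) \<in> C'" for n \<phi>
    using continuous_map_image_subset_topspace[OF cont] that C' by fastforce
  fix c assume c: "c \<in> C'"
  obtain n \<phi> where n: "c = (n, \<phi>)" by (cases c)
  have "compactin K (\<phi> ` closed_disc n)"
    using image_compactin[of "disc_top n" "closed_disc n" K \<phi>] compact_space_disc_top[of n] cont C' c n
    by (auto simp: compact_space_def)
  then have "closedin K (\<phi> ` closed_disc n)"
    using CW_structureD(1)[OF CW] compactin_imp_closedin by blast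
  then show "closedin ?X (case c of (n, \<phi>) \<Rightarrow> \<phi> ` closed_disc n)"
    using c n by (auto intro!: closedin_subset_topspace)
  let ?Y = "subtopology K (\<phi> ` closed_disc n)"
  have Y: "topspace ?Y = \<phi> ` closed_disc n" using img c n by auto
  have "quotient_map (disc_top n) ?Y \<phi>"
    using cont C' c n compact_space_disc_top CW_structureD(1)[OF CW] Y
    by (intro continuous_imp_quotient_map)
       (auto simp: Hausdorff_space_subtopology continuous_map_in_subtopology)
  then have "continuous_map ?Y S s"
    using s c n by (metis continuous_compose_quotient_map)
  moreover have "subtopology ?X (\<phi> ` closed_disc n) = ?Y"
    using c n by (auto simp: subtopology_subtopology intro!: arg_cong[of _ _ "subtopology K"])
  ultimately show "continuous_map (subtopology ?X (case c of (n, \<phi>) \<Rightarrow> \<phi> ` closed_disc n)) S s"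
    using n by simp
next
  fix x assume "x \<in> topspace (subtopology K (\<Union>(n, \<phi>) \<in> C'. \<phi> ` closed_disc n))"
  then show "\<exists>j. j \<in> C' \<and> x \<in> (case j of (n, \<phi>) \<Rightarrow> \<phi> ` closed_disc n) \<and> s x = s x"
    by auto
qed (use C' in auto)

text \<open>
  Obstruction theory in its simplest form: \<open>Fib k\<close> is the set of admissible values over \<open>k\<close>,
  and if admissible families over the boundary of a disc extend over the disc, then a
  section is built by induction over the skeleta.
\<close>

lemma CW_section_exists:
  fixes K :: "'k topology" and S :: "'s topology" and Fib :: "'k \<Rightarrow> 's set"
  assumes CW: "CW_structure K C"
    and ext: "\<And>n \<phi> \<tau>. \<lbrakk>continuous_map (disc_top n) K \<phi>;
        continuous_map (subtopology (disc_top n) (disc_boundary n)) S \<tau>;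
        \<And>d. d \<in> disc_boundary n \<Longrightarrow> \<tau> d \<in> Fib (\<phi> d)\<rbrakk> \<Longrightarrow>
        \<exists>\<tau>'. continuous_map (disc_top n) S \<tau>' \<and> (\<forall>d\<in>closed_disc n. \<tau>' d \<in> Fib (\<phi> d)) \<and>
            (\<forall>d\<in>disc_boundary n. \<tau>' d = \<tau> d)"
  shows "\<exists>s. continuous_map K S s \<and> (\<forall>k\<in>topspace K. s k \<in> Fib k)"
proof -
  \<comment> \<open>\<open>Sk n\<close> is the union of the cells of dimension below \<open>n\<close>, so that the induction starts from the empty set.\<close>
  define Sk where "Sk n = (\<Union>(k, \<phi>) \<in> {c \<in> C. fst c < n}. \<phi> ` open_disc k)" for n
  define P where "P n s \<longleftrightarrow> (\<forall>k \<phi>. (k, \<phi>) \<in> C \<longrightarrow> k < n \<longrightarrow>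
      continuous_map (disc_top k) S (s \<circ> \<phi>) \<and> (\<forall>d\<in>closed_disc k. s (\<phi> d) \<in> Fib (\<phi> d)))" for n s
  have bdry: "\<phi> ` disc_boundary n \<subseteq> Sk n" if c: "(n, \<phi>) \<in> C" for n \<phi>
  proof -
    obtain C' where C': "C' \<subseteq> C" "\<forall>(k, \<psi>) \<in> C'. k < n"
      "\<phi> ` disc_boundary n \<subseteq> (\<Union>(k, \<psi>) \<in> C'. \<psi> ` open_disc k)"
      using CW_structureD(6)[OF CW c] by blast
    have "(\<Union>(k, \<psi>) \<in> C'. \<psi> ` open_disc k) \<subseteq> Sk n"
      unfolding Sk_def using C'(1,2) by fastforce
    then show ?thesis using C'(3) by blast
  qed
  have Sk_mono: "Sk k \<subseteq> Sk n" if "k \<le> n" for k n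
    using that unfolding Sk_def by fastforce
  have cell: "\<phi> ` closed_disc k \<subseteq> Sk (Suc k)" if c: "(k, \<phi>) \<in> C" for k \<phi>
  proof -
    have "\<phi> ` open_disc k \<subseteq> Sk (Suc k)" unfolding Sk_def using c by fastforce
    moreover have "closed_disc k = open_disc k \<union> disc_boundary k"
      using open_disc_subset by (auto simp: disc_boundary_def)
    ultimately show ?thesis using bdry[OF c] Sk_mono[of k "Suc k"] by auto
  qed
  have step: "\<exists>s'. P (Suc n) s' \<and> (\<forall>x\<in>Sk n. s' x = s x)" if s: "P n s" for n s
  proof -
    have "\<exists>\<tau>. continuous_map (disc_top n) S \<tau> \<and> (\<forall>d\<in>closed_disc n. \<tau> d \<in> Fib (\<phi> d)) \<and>
            (\<forall>d\<in>disc_boundary n. \<tau> d = s (\<phi> d))" if c: "(n, \<phi>) \<in> C" for \<phi>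
    proof -
      obtain C' where C': "C' \<subseteq> C" "finite C'" "\<forall>(k, \<psi>) \<in> C'. k < n"
        "\<phi> ` disc_boundary n \<subseteq> (\<Union>(k, \<psi>) \<in> C'. \<psi> ` open_disc k)"
        using CW_structureD(6)[OF CW c] by blast
      let ?A = "\<Union>(k, \<psi>) \<in> C'. \<psi> ` closed_disc k"
      have sub: "\<phi> ` disc_boundary n \<subseteq> ?A"
        using C'(4) by (rule subset_trans) (intro UN_mono, use open_disc_subset in auto)
      have "continuous_map (subtopology K ?A) S s"
      proof (rule continuous_map_finite_closed_cells[OF CW C'(1,2)])
        fix k \<psi> assume "(k, \<psi>) \<in> C'"
        then have "(k, \<psi>) \<in> C" "k < n" using C'(1,3) by auto
        then show "continuous_map (disc_top k) S (s \<circ> \<psi>)" using s unfolding P_def by blast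
      qed
      moreover have "continuous_map (subtopology (disc_top n) (disc_boundary n)) (subtopology K ?A) \<phi>"
        using sub CW_structureD(2)[OF CW c]
        by (intro continuous_map_into_subtopology continuous_map_from_subtopology) (simp_all only: funcset_image topspace_subtopology image_subset_iff_funcset[symmetric] image_subset_iff, blast)
      ultimately have cont: "continuous_map (subtopology (disc_top n) (disc_boundary n)) S (s \<circ> \<phi>)"
        using continuous_map_compose by blast
      have vals: "(s \<circ> \<phi>) d \<in> Fib (\<phi> d)" if d: "d \<in> disc_boundary n" for d
      proof -
        obtain k \<psi> d' where "(k, \<psi>) \<in> C" "k < n" "d' \<in> closed_disc k" "\<phi> d = \<psi> d'"
          using subsetD[OF sub imageI[OF d]] C'(1,3) by blast
        then show ?thesis using s unfolding P_def by auto
      qed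
      from ext[OF CW_structureD(2)[OF CW c] cont vals] show ?thesis by (simp add: o_def)
    qed
    then obtain \<tau> where \<tau>: "\<And>\<phi>. (n, \<phi>) \<in> C \<Longrightarrow> continuous_map (disc_top n) S (\<tau> \<phi>)"
      "\<And>\<phi> d. (n, \<phi>) \<in> C \<Longrightarrow> d \<in> closed_disc n \<Longrightarrow> \<tau> \<phi> d \<in> Fib (\<phi> d)"
      "\<And>\<phi> d. (n, \<phi>) \<in> C \<Longrightarrow> d \<in> disc_boundary n \<Longrightarrow> \<tau> \<phi> d = s (\<phi> d)"
      by metis
    \<comment> \<open>The new values live on the open \<open>n\<close>-cells; a point determines its cell and its coordinate there.\<close>
    define Q where "Q x c \<longleftrightarrow> (n, fst c) \<in> C \<and> snd c \<in> open_disc n \<and> x = fst c (snd c)" for x c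
    define s' where "s' x = (if \<exists>c. Q x c then case SOME c. Q x c of (\<phi>, d) \<Rightarrow> \<tau> \<phi> d else s x)" for x
    have Q_unique: "c = (\<phi>, d)" if "Q (\<phi> d) c" "(n, \<phi>) \<in> C" "d \<in> open_disc n" for c \<phi> d
    proof -
      obtain \<psi> e where c: "c = (\<psi>, e)" by (cases c)
      have "\<psi> = \<phi>"
        using CW_structureD(4)[OF CW, of n \<psi> n \<phi>] that unfolding Q_def c by auto
      then show ?thesis
        using CW_structureD(3)[OF CW that(2)] that unfolding Q_def c inj_on_def by auto
    qed
    have s'_open: "s' (\<phi> d) = \<tau> \<phi> d" if "(n, \<phi>) \<in> C" "d \<in> open_disc n" for \<phi> d
    proof -
      have Q: "Q (\<phi> d) (\<phi>, d)" using that by (simp add: Q_def)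
      then have "(SOME c. Q (\<phi> d) c) = (\<phi>, d)"
        using Q_unique[OF _ that] someI[of "Q (\<phi> d)"] by metis
      then show ?thesis using Q by (auto simp: s'_def)
    qed
    have s'_old: "s' x = s x" if x: "x \<in> Sk n" for x
    proof -
      obtain k \<psi> where "(k, \<psi>) \<in> C" "k < n" "x \<in> \<psi> ` open_disc k"
        using x unfolding Sk_def by auto
      then have "\<not> Q x c" for c
        using CW_structureD(4)[OF CW, of n "fst c" k \<psi>] unfolding Q_def by auto
      then show ?thesis by (simp add: s'_def)
    qed
    have "P (Suc n) s'"
      unfolding P_def
    proof (intro allI impI)
      fix k \<phi> assume c: "(k, \<phi>) \<in> C" and "k < Suc n"
      then consider "k = n" | "k < n" by linarith
      then show "continuous_map (disc_top k) S (s' \<circ> \<phi>) \<and> (\<forall>d\<in>closed_disc k. s' (\<phi> d) \<in> Fib (\<phi> d))"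
      proof cases
        case 1
        have "s' (\<phi> d) = \<tau> \<phi> d" if "d \<in> closed_disc n" for d
        proof (cases "d \<in> open_disc n")
          case True
          then show ?thesis using s'_open c 1 by simp
        next
          case False
          then have d: "d \<in> disc_boundary n" using that by (simp add: disc_boundary_def)
          then have "\<phi> d \<in> Sk n" using bdry c 1 by blast
          then show ?thesis using s'_old \<tau>(3) c 1 d by simp
        qed
        then show ?thesis
          using \<tau>(1,2) c 1 by (auto intro!: continuous_map_eq[OF \<tau>(1)])
      next
        case 2
        have "s' (\<phi> d) = s (\<phi> d)" if "d \<in> closed_disc k" for d
        proof (rule s'_old)
          have "\<phi> d \<in> Sk (Suc k)" using cell[OF c] that by (rule subsetD[OF _ imageI])
          then show "\<phi> d \<in> Sk n" using Sk_mono[of "Suc k" n] 2 by (meson Suc_leI subsetD)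
        qed
        moreover have "continuous_map (disc_top k) S (s \<circ> \<phi>)" "\<forall>d\<in>closed_disc k. s (\<phi> d) \<in> Fib (\<phi> d)"
          using s c 2 unfolding P_def by blast+
        ultimately show ?thesis
          by (auto elim!: continuous_map_eq)
      qed
    qed
    then show ?thesis using s'_old by blast
  qed
  have "P 0 (\<lambda>_. undefined)" by (simp add: P_def)
  then obtain \<sigma> where \<sigma>: "\<And>n. P n (\<sigma> n)" "\<And>n x. x \<in> Sk n \<Longrightarrow> \<sigma> (Suc n) x = \<sigma> n x"
    using dependent_nat_choice[of P "\<lambda>n s s'. \<forall>x\<in>Sk n. s' x = s x"] step by metis
  have \<sigma>_mono: "\<sigma> n x = \<sigma> k x" if "k \<le> n" "x \<in> Sk k" for k n x
    using that(1)
  proof (induction n rule: dec_induct)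
    case (step n)
    then have "x \<in> Sk n" using Sk_mono that(2) by blast
    then show ?case using \<sigma>(2) step by simp
  qed simp
  define s where "s x = \<sigma> (LEAST n. x \<in> Sk n) x" for x
  have s_eq: "s x = \<sigma> n x" if "x \<in> Sk n" for n x
    using \<sigma>_mono[of "LEAST n. x \<in> Sk n" n x] LeastI[of "\<lambda>n. x \<in> Sk n", OF that]
      Least_le[of "\<lambda>n. x \<in> Sk n", OF that] by (simp add: s_def)
  have s_cell: "continuous_map (disc_top k) S (s \<circ> \<phi>) \<and> (\<forall>d\<in>closed_disc k. s (\<phi> d) \<in> Fib (\<phi> d))"
    if c: "(k, \<phi>) \<in> C" for k \<phi>
  proof -
    have eq: "s (\<phi> d) = \<sigma> (Suc k) (\<phi> d)" if "d \<in> closed_disc k" for d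
      by (rule s_eq[OF subsetD[OF cell[OF c] imageI[OF that]]])
    have "continuous_map (disc_top k) S (\<sigma> (Suc k) \<circ> \<phi>) \<and>
        (\<forall>d\<in>closed_disc k. \<sigma> (Suc k) (\<phi> d) \<in> Fib (\<phi> d))"
      using \<sigma>(1)[of "Suc k"] c unfolding P_def by blast
    then show ?thesis using eq by (auto elim!: continuous_map_eq)
  qed
  have cover: "\<exists>k \<phi> d. (k, \<phi>) \<in> C \<and> d \<in> closed_disc k \<and> x = \<phi> d" if x: "x \<in> topspace K" for x
  proof -
    obtain c where "c \<in> C" "x \<in> snd c ` open_disc (fst c)"
      using x unfolding CW_structureD(5)[OF CW, symmetric] by (auto simp: case_prod_beta)
    then show ?thesis using open_disc_subset by (metis (no_types, lifting) imageE prod.collapse subsetD)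
  qed
  have Fib: "s x \<in> Fib x" if "x \<in> topspace K" for x
    using cover[OF that] s_cell by blast
  have "continuous_map K S s"
    unfolding continuous_map_closedin
  proof (intro conjI allI impI Pi_I)
    fix x assume x: "x \<in> topspace K"
    show "s x \<in> topspace S"
    proof -
      obtain k \<phi> d where "(k, \<phi>) \<in> C" "d \<in> closed_disc k" "x = \<phi> d" using cover[OF x] by blast
      then show ?thesis
        using s_cell continuous_map_image_subset_topspace[of "disc_top k" S "s \<circ> \<phi>"] by auto
    qed
  next
    fix V assume V: "closedin S V"
    show "closedin K {x \<in> topspace K. s x \<in> V}"
    proof (rule CW_structureD(7)[OF CW])
      fix n \<phi> assume c: "(n, \<phi>) \<in> C"
      have "\<phi> ` closed_disc n \<subseteq> topspace K"
        using continuous_map_image_subset_topspace[OF CW_structureD(2)[OF CW c]] by simp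
      then have "{x \<in> closed_disc n. \<phi> x \<in> {x \<in> topspace K. s x \<in> V}} =
          {x \<in> topspace (disc_top n). (s \<circ> \<phi>) x \<in> V}" by auto
      then show "closedin (disc_top n) {x \<in> closed_disc n. \<phi> x \<in> {x \<in> topspace K. s x \<in> V}}"
        using closedin_continuous_map_preimage[of "disc_top n" S "s \<circ> \<phi>" V] s_cell[OF c] V by simp
    qed auto
  qed
  then show ?thesis using Fib by blast
qed

section \<open>Lifting over a cone\<close>

text \<open>
  The homotopy fibre of a map \<open>r\<^sub>u\<close> that is homotopic to the identity is contractible: a point
  \<open>z\<close> with a path \<open>W\<close> from \<open>r\<^sub>u z\<close> to \<open>y\<close> moves to the point \<open>y\<close>. The composite \<open>W'\<close> of the
  reversed track of \<open>z\<close> with \<open>W\<close> is a path from \<open>z\<close> to \<open>y\<close>. In the first half of the deformation the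
  point stays at \<open>z\<close>, and the track of \<open>z\<close> followed by its inverse grows in front of \<open>W\<close>; in the
  second half the point slides along \<open>W'\<close>. The terminal value does not depend on \<open>z\<close> and \<open>W\<close>,
  which is what allows it to be extended later to parameters where these are not given.
\<close>

lemma homotopy_fibre_contraction:
  assumes z: "continuous_map U G z" and y: "continuous_map U G y"
    and h: "continuous_map (prod_topology unit_interval (prod_topology U G)) G h"
    and h0: "\<And>u x. u \<in> topspace U \<Longrightarrow> x \<in> topspace G \<Longrightarrow> h (0, (u, x)) = r (u, x)"
    and h1: "\<And>u x. u \<in> topspace U \<Longrightarrow> x \<in> topspace G \<Longrightarrow> h (1, (u, x)) = x"
    and W: "continuous_map (prod_topology unit_interval U) G W"
    and W0: "\<And>u. u \<in> topspace U \<Longrightarrow> W (0, u) = r (u, z u)"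
    and W1: "\<And>u. u \<in> topspace U \<Longrightarrow> W (1, u) = y u"
  obtains Z \<Omega> where
    "continuous_map (prod_topology unit_interval U) G Z"
    "continuous_map (prod_topology unit_interval (prod_topology unit_interval U)) G \<Omega>"
    "\<And>u. u \<in> topspace U \<Longrightarrow> Z (0, u) = z u" "\<And>u. u \<in> topspace U \<Longrightarrow> Z (1, u) = y u"
    "\<And>u l. u \<in> topspace U \<Longrightarrow> l \<in> {0..1} \<Longrightarrow> \<Omega> (0, (l, u)) = r (u, Z (l, u))"
    "\<And>u l. u \<in> topspace U \<Longrightarrow> l \<in> {0..1} \<Longrightarrow> \<Omega> (1, (l, u)) = y u"
    "\<And>u s. u \<in> topspace U \<Longrightarrow> s \<in> {0..1} \<Longrightarrow> \<Omega> (s, (0, u)) = W (s, u)"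
    "\<And>u s. u \<in> topspace U \<Longrightarrow> s \<in> {0..1} \<Longrightarrow> \<Omega> (s, (1, u)) = h (unit_clamp (3 * s), (u, y u))"
proof -
  have zG: "z u \<in> topspace G" and yG: "y u \<in> topspace G" if "u \<in> topspace U" for u
    using z y that by (auto simp: continuous_map_def)
  define W' where "W' = (\<lambda>p. if fst p \<le> 1/2 then h (unit_clamp (1 - 2 * fst p), (snd p, z (snd p)))
      else W (unit_clamp (2 * fst p - 1), snd p))"
  have W': "continuous_map (prod_topology unit_interval U) G W'"
    unfolding W'_def
  proof (rule continuous_map_cases_le)
    show "h (unit_clamp (1 - 2 * fst p), snd p, z (snd p)) = W (unit_clamp (2 * fst p - 1), snd p)"
      if p: "p \<in> topspace (prod_topology unit_interval U)" "fst p = 1/2" for p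
    proof -
      obtain u where "p = (1/2, u)" using p(2) by (metis prod.collapse)
      then show ?thesis using p h0 W0 zG by auto
    qed
  qed (intro continuous_intros continuous_map_from_subtopology continuous_map_compose2[OF h]
        continuous_map_compose2[OF W] continuous_map_compose2[OF z])+
  have W'0: "W' (0, u) = z u" and W'1: "W' (1, u) = y u" if "u \<in> topspace U" for u
    using that h1 W1 zG by (auto simp: W'_def)
  have W'G: "W' (s, u) \<in> topspace G" if "u \<in> topspace U" "s \<in> {0..1}" for s u
    using W' that by (auto simp: continuous_map_def Pi_iff)
  let ?II = "prod_topology unit_interval (prod_topology unit_interval U)"
  have II: "continuous_map ?II euclideanreal fst" "continuous_map ?II euclideanreal (\<lambda>p. fst (snd p))"
    "continuous_map ?II U (\<lambda>p. snd (snd p))"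
    using continuous_map_compose2[OF continuous_map_fst_real continuous_map_snd]
      continuous_map_compose2[OF continuous_map_snd continuous_map_snd]
    by (auto intro!: continuous_intros)
  define Z where "Z = (\<lambda>p. W' (unit_clamp (2 * fst p - 1), snd p))"
  \<comment> \<open>The two halves of the deformation. In \<open>A\<close> the detour along the track has length \<open>2 * a\<close> and \<open>W\<close> has
    length 1; for \<open>a = 1\<close> each of the three pieces takes a third of the time, which fixes the
    parametrization in \<open>D\<close>.\<close>
  define A where "A = (\<lambda>p. let a = unit_clamp (2 * fst (snd p)); v = (1 + 2 * a) * fst p; u = snd (snd p) in
      if v \<le> 2 * a then h (unit_clamp (min v (2 * a - v)), (u, z u)) else W (unit_clamp (v - 2 * a), u))"
  define D where "D = (\<lambda>p. let a = unit_clamp (2 * fst (snd p) - 1); s = fst p; u = snd (snd p) in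
      if s \<le> 1/3 then h (unit_clamp (3 * s), (u, W' (a, u)))
      else W' (unit_clamp (a + (1 - a) * (3 * s - 1) / 2), u))"
  define \<Omega> where "\<Omega> = (\<lambda>p. if fst (snd p) \<le> 1/2 then A p else D p)"
  have clamp_real: "continuous_map X euclideanreal (\<lambda>x. unit_clamp (f x))"
    if "continuous_map X euclideanreal f" for X :: "'z topology" and f
    using continuous_map_unit_clamp[OF that] by (rule continuous_map_from_unit_interval)
  have contZ: "continuous_map (prod_topology unit_interval U) G Z"
    unfolding Z_def by (intro continuous_map_compose2[OF W'] continuous_intros)
  have contA: "continuous_map ?II G A"
    unfolding A_def Let_def
  proof (rule continuous_map_cases_le)
    fix p assume "p \<in> topspace ?II"
      and *: "(1 + 2 * unit_clamp (2 * fst (snd p))) * fst p = 2 * unit_clamp (2 * fst (snd p))"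
    then show "h (unit_clamp (min ((1 + 2 * unit_clamp (2 * fst (snd p))) * fst p)
           (2 * unit_clamp (2 * fst (snd p)) - (1 + 2 * unit_clamp (2 * fst (snd p))) * fst p)),
         snd (snd p), z (snd (snd p))) =
      W (unit_clamp ((1 + 2 * unit_clamp (2 * fst (snd p))) * fst p - 2 * unit_clamp (2 * fst (snd p))), snd (snd p))"
      unfolding * using h0 W0 zG by auto
  qed (intro continuous_intros continuous_map_from_subtopology continuous_map_compose2[OF h]
        continuous_map_compose2[OF W] continuous_map_compose2[OF z] clamp_real II)+
  have contD: "continuous_map ?II G D"
    unfolding D_def Let_def
  proof (rule continuous_map_cases_le)
    fix p assume p: "p \<in> topspace ?II" "fst p = 1/3"
    then obtain l u where "p = (1/3, l, u)" by (metis prod.collapse)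
    with p show "h (unit_clamp (3 * fst p), snd (snd p), W' (unit_clamp (2 * fst (snd p) - 1), snd (snd p))) =
         W' (unit_clamp (unit_clamp (2 * fst (snd p) - 1) +
           (1 - unit_clamp (2 * fst (snd p) - 1)) * (3 * fst p - 1) / 2), snd (snd p))"
      using h1[OF _ W'G] by (auto simp: mem_Times_iff)
  qed (intro continuous_intros continuous_map_from_subtopology continuous_map_compose2[OF h]
        continuous_map_compose2[OF W'] clamp_real II | simp)+
  have "continuous_map ?II G \<Omega>"
    unfolding \<Omega>_def
  proof (rule continuous_map_cases_le)
    fix p assume p: "p \<in> topspace ?II" "fst (snd p) = 1/2"
    obtain s u where pe: "p = (s, 1/2, u)" using p(2) by (metis prod.collapse)
    then have su: "u \<in> topspace U" "0 \<le> s" "s \<le> 1" using p by auto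
    have A: "A p = (if 3 * s \<le> 2 then h (unit_clamp (min (3 * s) (2 - 3 * s)), (u, z u))
        else W (unit_clamp (3 * s - 2), u))"
      by (simp add: pe A_def Let_def)
    have D: "D p = (if s \<le> 1/3 then h (unit_clamp (3 * s), (u, W' (0, u)))
        else W' (unit_clamp ((3 * s - 1) / 2), u))"
      by (simp add: pe D_def Let_def)
    show "A p = D p"
    proof (cases "s \<le> 1/3")
      case True
      then have "3 * s \<le> 2" "min (3 * s) (2 - 3 * s) = 3 * s" by auto
      then show ?thesis using True su W'0 by (simp only: A D if_True)
    next
      case False
      let ?q = "(3 * s - 1) / 2"
      have q: "unit_clamp ?q = ?q" using False su by (intro unit_clamp_id) auto
      have e: "1 - 2 * ?q = 2 - 3 * s" "2 * ?q - 1 = 3 * s - 2" by (auto simp: field_simps)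
      have "min (3 * s) (2 - 3 * s) = 2 - 3 * s" "(3 * s \<le> 2) = (?q \<le> 1/2)" using False by auto
      then show ?thesis unfolding A D q W'_def fst_conv snd_conv e using False by simp
    qed
  qed (intro continuous_intros continuous_map_from_subtopology contA contD II)+
  moreover have "\<Omega> (0, (l, u)) = r (u, Z (l, u))" if "u \<in> topspace U" "l \<in> {0..1}" for u l
    using that h0 zG W'0 W'G by (auto simp: \<Omega>_def A_def D_def Z_def Let_def)
  moreover have "\<Omega> (1, (l, u)) = y u" if "u \<in> topspace U" "l \<in> {0..1}" for u l
  proof -
    have e: "(4 - 4 * l) / 2 = 2 - 2 * l" by (simp add: field_simps)
    show ?thesis using that W1 W'1 by (auto simp: \<Omega>_def A_def D_def Let_def e)
  qed
  moreover have "\<Omega> (s, (0, u)) = W (s, u)" if "u \<in> topspace U" "s \<in> {0..1}" for u s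
    using that h0 W0 zG by (auto simp: \<Omega>_def A_def)
  moreover have "\<Omega> (s, (1, u)) = h (unit_clamp (3 * s), (u, y u))" if "u \<in> topspace U" "s \<in> {0..1}" for u s
    using that W'1 h1 yG by (auto simp: \<Omega>_def D_def)
  moreover have "Z (0, u) = z u" "Z (1, u) = y u" if "u \<in> topspace U" for u
    using that W'0 W'1 by (auto simp: Z_def)
  ultimately show thesis using that contZ by blast
qed

text \<open>
  The model is a compact convex body seen from an interior point \<open>b0\<close>: \<open>N\<close> is its gauge, and \<open>sc r\<close> is the
  homothety with centre \<open>b0\<close> and ratio \<open>r\<close>, which may also push outwards as long as it stays in
  the body.
\<close>

locale radial_cone =
  fixes B :: "'b topology" and N :: "'b \<Rightarrow> real" and sc :: "real \<Rightarrow> 'b \<Rightarrow> 'b" and b0 :: 'b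
  assumes continuous_gauge: "continuous_map B euclideanreal N"
    and gauge_range: "b \<in> topspace B \<Longrightarrow> 0 \<le> N b \<and> N b \<le> 1"
    and continuous_scale: "continuous_map
          (subtopology (prod_topology euclideanreal B) {p. 0 \<le> fst p \<and> fst p * N (snd p) \<le> 1}) B
          (\<lambda>p. sc (fst p) (snd p))"
    and gauge_scale: "b \<in> topspace B \<Longrightarrow> 0 \<le> r \<Longrightarrow> r * N b \<le> 1 \<Longrightarrow> N (sc r b) = r * N b"
    and scale_1: "sc 1 b = b"
    and scale_0: "b \<in> topspace B \<Longrightarrow> sc 0 b = b0"
    and apex: "b0 \<in> topspace B"
begin

definition rim :: "'b set" where
  "rim = {b. N b = 1}"

lemma continuous_map_scale:
  assumes "continuous_map X euclideanreal f" "continuous_map X B g"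
    and "\<And>x. x \<in> topspace X \<Longrightarrow> 0 \<le> f x \<and> f x * N (g x) \<le> 1"
  shows "continuous_map X B (\<lambda>x. sc (f x) (g x))"
proof -
  have "continuous_map X (subtopology (prod_topology euclideanreal B) {p. 0 \<le> fst p \<and> fst p * N (snd p) \<le> 1})
      (\<lambda>x. (f x, g x))"
    by (intro continuous_map_into_subtopology continuous_map_pairedI assms(1,2)) (use assms(3) in auto)
  from continuous_map_compose2[OF continuous_scale this] show ?thesis by simp
qed

lemma homotopic_maps_apex:
  assumes "continuous_map B G y"
  shows "homotopic_maps B G y (\<lambda>_. y b0)"
proof -
  have "continuous_map (prod_topology unit_interval B) B (\<lambda>p. sc (1 - fst p) (snd p))"
  proof (rule continuous_map_scale)
    fix p assume p: "p \<in> topspace (prod_topology unit_interval B)"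
    then have "(1 - fst p) * N (snd p) \<le> 1 * 1"
      using gauge_range by (intro mult_mono) auto
    then show "0 \<le> 1 - fst p \<and> (1 - fst p) * N (snd p) \<le> 1"
      using p by auto
  qed (intro continuous_intros)+
  then show ?thesis
    unfolding homotopic_maps_iff
    by (intro exI[of _ "\<lambda>p. y (sc (1 - fst p) (snd p))"])
       (auto simp: scale_0 scale_1 intro: continuous_map_compose2[OF assms])
qed

text \<open>
  Here \<open>r\<close> is a family of self-maps of \<open>G\<close> over the cone, homotopic to the identity family, and a
  lift consists of a point \<open>z b\<close> with a path from \<open>r (b, z b)\<close> to \<open>y b\<close>. A lift over the rim extends: on the collar where the gauge is
  at least a half it is carried along the radius and contracted at the same time, and the
  terminal value of the contraction extends over the rest of the cone. Carrying a lift along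
  a piece of radius of length \<open>l\<close> prolongs the path by a piece of length \<open>l\<close> at both ends, so
  that nothing happens for \<open>l = 0\<close>, that is, on the rim.
\<close>

lemma lift_extension:
  assumes y: "continuous_map B G y"
    and r: "homotopic_maps (prod_topology B G) G r snd"
    and z: "continuous_map (subtopology B rim) G z"
    and \<omega>: "continuous_map (prod_topology unit_interval (subtopology B rim)) G \<omega>"
    and \<omega>0: "\<And>c. c \<in> topspace B \<Longrightarrow> c \<in> rim \<Longrightarrow> \<omega> (0, c) = r (c, z c)"
    and \<omega>1: "\<And>c. c \<in> topspace B \<Longrightarrow> c \<in> rim \<Longrightarrow> \<omega> (1, c) = y c"
  obtains z' \<omega>' where "continuous_map B G z'" "continuous_map (prod_topology unit_interval B) G \<omega>'"
    "\<And>b. b \<in> topspace B \<Longrightarrow> \<omega>' (0, b) = r (b, z' b)"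
    "\<And>b. b \<in> topspace B \<Longrightarrow> \<omega>' (1, b) = y b"
    "\<And>c. c \<in> topspace B \<Longrightarrow> c \<in> rim \<Longrightarrow> z' c = z c"
    "\<And>c s. c \<in> topspace B \<Longrightarrow> c \<in> rim \<Longrightarrow> s \<in> {0..1} \<Longrightarrow> \<omega>' (s, c) = \<omega> (s, c)"
proof -
  obtain h where h: "continuous_map (prod_topology unit_interval (prod_topology B G)) G h"
    and h0: "\<And>b x. b \<in> topspace B \<Longrightarrow> x \<in> topspace G \<Longrightarrow> h (0, (b, x)) = r (b, x)"
    and h1: "\<And>b x. b \<in> topspace B \<Longrightarrow> x \<in> topspace G \<Longrightarrow> h (1, (b, x)) = x"
    using r unfolding homotopic_maps_iff by auto
  define V where "V = {b \<in> topspace B. 1/2 \<le> N b}"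
  let ?V = "subtopology B V" and ?J = "prod_topology unit_interval (subtopology B V)"
  have V: "b \<in> topspace B" "1/2 \<le> N b" "N b \<le> 1" "0 < N b" if "b \<in> V" for b
    using that gauge_range[of b] by (auto simp: V_def)
  have Vpos: "N b \<noteq> 0" if "b \<in> V" for b
    using V(4)[OF that] by auto
  have tV: "topspace ?V = V" by (auto simp: V_def)
  have cB: "continuous_map ?V B (\<lambda>b. b)" by (simp add: continuous_map_from_subtopology)
  have cN: "continuous_map ?V euclideanreal N"
    by (rule continuous_map_from_subtopology[OF continuous_gauge])
  have cBJ: "continuous_map ?J B snd" "continuous_map ?J euclideanreal (\<lambda>p. N (snd p))"
    using continuous_map_compose2[OF cB continuous_map_snd] continuous_map_compose2[OF cN continuous_map_snd]
    by auto
  \<comment> \<open>The radial projection to the rim and the radius from there towards the apex; \<open>b\<close> is reached at time \<open>1 - N b\<close>.\<close>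
  define c where "c b = sc (1 / N b) b" for b
  have c_rim: "c b \<in> rim" if "b \<in> V" for b
    unfolding rim_def c_def using gauge_scale[of b "1 / N b"] V[OF that] by auto
  have c: "continuous_map ?V (subtopology B rim) c"
  proof (rule continuous_map_into_subtopology)
    show "continuous_map ?V B c"
      unfolding c_def
    proof (rule continuous_map_scale)
      show "continuous_map ?V euclideanreal (\<lambda>b. 1 / N b)"
        using Vpos by (intro continuous_map_real_divide cN) (auto simp: tV)
    qed (use V Vpos cB less_imp_le[OF V(4)] in \<open>auto simp: tV\<close>)
  qed (use c_rim tV in auto)
  have c_id: "c b = b" if "N b = 1" for b
    using that by (simp add: c_def scale_1)
  define \<kappa> where "\<kappa> p = sc ((1 - unit_clamp (fst p)) / N (snd p)) (snd p)" for p
  have \<kappa>: "continuous_map ?J B \<kappa>"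
    unfolding \<kappa>_def
  proof (rule continuous_map_scale)
    have uc: "continuous_map ?J euclideanreal (\<lambda>p. unit_clamp (fst p))"
      by (rule continuous_map_from_unit_interval) (intro continuous_intros)
    have "N (snd p) \<noteq> 0" if "p \<in> topspace ?J" for p
      using that Vpos[of "snd p"] tV by (simp add: mem_Times_iff)
    then show "continuous_map ?J euclideanreal (\<lambda>p. (1 - unit_clamp (fst p)) / N (snd p))"
      by (intro continuous_map_real_divide continuous_map_diff cBJ uc) simp_all
  next
    fix p assume "p \<in> topspace ?J"
    then have "snd p \<in> V" using tV by (simp add: mem_Times_iff)
    with V(4)[of "snd p"] show "0 \<le> (1 - unit_clamp (fst p)) / N (snd p) \<and>
        (1 - unit_clamp (fst p)) / N (snd p) * N (snd p) \<le> 1" by simp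
  qed (rule cBJ)
  have \<kappa>0: "\<kappa> (0, b) = c b" for b
    by (simp add: \<kappa>_def c_def)
  have \<kappa>1: "\<kappa> (1 - N b, b) = b" if "b \<in> V" for b
    using V[OF that] by (simp add: \<kappa>_def scale_1)
  \<comment> \<open>The time on the prolonged path, which runs from \<open>-l\<close> to \<open>1 + l\<close> for \<open>l = 1 - N b\<close>.\<close>
  define v where "v p = (1 + 2 * (1 - N (snd p))) * fst p - (1 - N (snd p))" for p :: "real \<times> 'b"
  define W where "W p = (if v p \<le> 0 then r (\<kappa> (unit_clamp (- v p), snd p), z (c (snd p)))
      else if v p \<le> 1 then \<omega> (unit_clamp (v p), c (snd p))
      else y (\<kappa> (unit_clamp (v p - 1), snd p)))" for p
  have cv: "continuous_map ?J euclideanreal v"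
    unfolding v_def by (intro continuous_intros cBJ)
  have r': "continuous_map (prod_topology B G) G r"
    using homotopic_maps_continuous(1)[OF r] .
  have cW: "continuous_map ?J G W"
    unfolding W_def
  proof (rule continuous_map_cases_le)
    show "continuous_map (subtopology ?J {x \<in> topspace ?J. 0 \<le> v x}) G
      (\<lambda>p. if v p \<le> 1 then \<omega> (unit_clamp (v p), c (snd p)) else y (\<kappa> (unit_clamp (v p - 1), snd p)))"
    proof (rule continuous_map_from_subtopology, rule continuous_map_cases_le)
      fix p assume "p \<in> topspace ?J" "v p = 1"
      moreover from this have "c (snd p) \<in> topspace B" "c (snd p) \<in> rim"
        using c_rim c tV by (auto simp: continuous_map_def Pi_iff)
      ultimately show "\<omega> (unit_clamp (v p), c (snd p)) = y (\<kappa> (unit_clamp (v p - 1), snd p))"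
        by (simp add: \<omega>1 \<kappa>0)
    qed (intro continuous_intros continuous_map_from_subtopology cv continuous_map_compose2[OF \<omega>]
        continuous_map_compose2[OF c] continuous_map_compose2[OF y] continuous_map_compose2[OF \<kappa>])+
  next
    fix p assume "p \<in> topspace ?J" "v p = 0"
    moreover from this have "c (snd p) \<in> topspace B" "c (snd p) \<in> rim"
      using c_rim c tV by (auto simp: continuous_map_def Pi_iff)
    ultimately show "r (\<kappa> (unit_clamp (- v p), snd p), z (c (snd p))) =
        (if v p \<le> 1 then \<omega> (unit_clamp (v p), c (snd p)) else y (\<kappa> (unit_clamp (v p - 1), snd p)))"
      by (simp add: \<omega>0 \<kappa>0)
  qed (intro continuous_intros continuous_map_from_subtopology cv continuous_map_compose2[OF r']
      continuous_map_compose2[OF z] continuous_map_compose2[OF c] continuous_map_compose2[OF \<kappa>])+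
  have W0: "W (0, b) = r (b, z (c b))" if "b \<in> V" for b
    using V[OF that] \<kappa>1[OF that] by (simp add: W_def v_def)
  have cBr: "c b \<in> topspace B" if "b \<in> V" for b
    using c that tV by (auto simp: continuous_map_def Pi_iff)
  have W1: "W (1, b) = y b" if b: "b \<in> V" for b
  proof (cases "N b = 1")
    case True
    then show ?thesis using \<omega>1[OF cBr c_rim, OF b b] by (simp add: W_def v_def c_id)
  next
    case False
    then show ?thesis using V[OF b] \<kappa>1[OF b] by (simp add: W_def v_def)
  qed
  have W_rim: "W (s, b) = \<omega> (s, b)" if b: "b \<in> V" "N b = 1" "s \<in> {0..1}" for s b
    using that \<omega>0[OF cBr c_rim, OF b(1,1)] W0[OF b(1)]
    by (auto simp: W_def v_def c_id \<kappa>0)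
  have hV: "continuous_map (prod_topology unit_interval (prod_topology ?V G)) G h"
  proof -
    have "continuous_map (prod_topology unit_interval (prod_topology ?V G))
        (prod_topology unit_interval (prod_topology B G)) (\<lambda>p. (fst p, fst (snd p), snd (snd p)))"
      by (intro continuous_intros continuous_map_compose2[OF cB]
          continuous_map_compose2[OF continuous_map_fst continuous_map_snd]
          continuous_map_compose2[OF continuous_map_snd continuous_map_snd])
    from continuous_map_compose2[OF h this] show ?thesis by simp
  qed
  obtain Z \<Omega> where Z: "continuous_map ?J G Z"
    and \<Omega>: "continuous_map (prod_topology unit_interval ?J) G \<Omega>"
    and Z0: "\<And>u. u \<in> V \<Longrightarrow> Z (0, u) = z (c u)" and Z1: "\<And>u. u \<in> V \<Longrightarrow> Z (1, u) = y u"
    and \<Omega>0: "\<And>u l. u \<in> V \<Longrightarrow> l \<in> {0..1} \<Longrightarrow> \<Omega> (0, (l, u)) = r (u, Z (l, u))"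
    and \<Omega>1: "\<And>u l. u \<in> V \<Longrightarrow> l \<in> {0..1} \<Longrightarrow> \<Omega> (1, (l, u)) = y u"
    and \<Omega>W: "\<And>u s. u \<in> V \<Longrightarrow> s \<in> {0..1} \<Longrightarrow> \<Omega> (s, (0, u)) = W (s, u)"
    and \<Omega>h: "\<And>u s. u \<in> V \<Longrightarrow> s \<in> {0..1} \<Longrightarrow> \<Omega> (s, (1, u)) = h (unit_clamp (3 * s), (u, y u))"
    by (rule homotopy_fibre_contraction[of ?V G "\<lambda>b. z (c b)" y h r W])
       (use h0 h1 W0 W1 V hV cW in \<open>auto simp: tV intro: continuous_map_compose2[OF z c]
          continuous_map_from_subtopology[OF y]\<close>)
  define z' where "z' b = (if 1/2 \<le> N b then Z (unit_clamp (2 - 2 * N b), b) else y b)" for b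
  define \<omega>' where "\<omega>' p = (if 1/2 \<le> N (snd p) then \<Omega> (fst p, (unit_clamp (2 - 2 * N (snd p)), snd p))
      else h (unit_clamp (3 * fst p), (snd p, y (snd p))))" for p
  have yG: "y b \<in> topspace G" if "b \<in> topspace B" for b
    using y that by (auto simp: continuous_map_def)
  have z'_cont: "continuous_map B G z'"
    unfolding z'_def
  proof (rule continuous_map_cases_le)
    show "continuous_map (subtopology B {b \<in> topspace B. 1/2 \<le> N b}) G (\<lambda>b. Z (unit_clamp (2 - 2 * N b), b))"
      unfolding V_def[symmetric] by (intro continuous_map_compose2[OF Z] continuous_intros cN) simp
    fix b assume b: "b \<in> topspace B" "1/2 = N b"
    then have "b \<in> V" "2 - 2 * N b = 1" by (auto simp: V_def)
    then show "Z (unit_clamp (2 - 2 * N b), b) = y b" using Z1 by simp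
  qed (intro continuous_intros continuous_gauge continuous_map_from_subtopology y)+
  let ?I = "prod_topology unit_interval B"
  have \<omega>'_cont: "continuous_map ?I G \<omega>'"
    unfolding \<omega>'_def
  proof (rule continuous_map_cases_le)
    have NI: "continuous_map ?I euclideanreal (\<lambda>p. N (snd p))"
      by (rule continuous_map_compose2[OF continuous_gauge continuous_map_snd])
    show "continuous_map ?I euclideanreal (\<lambda>p. N (snd p))" by (rule NI)
    let ?S = "subtopology ?I {p \<in> topspace ?I. 1/2 \<le> N (snd p)}"
    have "continuous_map ?S ?V snd"
      by (intro continuous_map_into_subtopology continuous_map_from_subtopology continuous_map_snd)
         (auto simp: V_def)
    then show "continuous_map ?S G (\<lambda>p. \<Omega> (fst p, (unit_clamp (2 - 2 * N (snd p)), snd p)))"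
      by (intro continuous_map_compose2[OF \<Omega>] continuous_intros continuous_map_from_subtopology[OF NI]
          continuous_map_from_subtopology[OF continuous_map_fst])
    show "continuous_map (subtopology ?I {p \<in> topspace ?I. N (snd p) \<le> 1/2}) G
        (\<lambda>p. h (unit_clamp (3 * fst p), (snd p, y (snd p))))"
      by (intro continuous_map_from_subtopology continuous_map_compose2[OF h] continuous_intros
          continuous_map_compose2[OF y])
    fix p assume p: "p \<in> topspace ?I" "1/2 = N (snd p)"
    then have "snd p \<in> V" "2 - 2 * N (snd p) = 1" by (auto simp: V_def)
    then show "\<Omega> (fst p, (unit_clamp (2 - 2 * N (snd p)), snd p)) = h (unit_clamp (3 * fst p), (snd p, y (snd p)))"
      using \<Omega>h[of "snd p" "fst p"] p(1) by (simp add: mem_Times_iff)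
  qed simp
  have "\<omega>' (0, b) = r (b, z' b)" if b: "b \<in> topspace B" for b
    using \<Omega>0[of b "unit_clamp (2 - 2 * N b)"] b h0[OF b yG[OF b]] by (auto simp: \<omega>'_def z'_def V_def)
  moreover have "\<omega>' (1, b) = y b" if b: "b \<in> topspace B" for b
    using \<Omega>1[of b "unit_clamp (2 - 2 * N b)"] b h1[OF b yG[OF b]] by (auto simp: \<omega>'_def V_def)
  moreover have "z' c = z c" "s \<in> {0..1} \<Longrightarrow> \<omega>' (s, c) = \<omega> (s, c)" if "c \<in> topspace B" "c \<in> rim" for c s
    using Z0[of c] \<Omega>W[of c s] W_rim[of c s] c_id[of c] that by (auto simp: z'_def \<omega>'_def V_def rim_def)
  ultimately show thesis using that z'_cont \<omega>'_cont by blast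
qed

end

section \<open>Right cancellation over CW complexes\<close>

definition disc_norm :: "nat \<Rightarrow> (nat \<Rightarrow> real) \<Rightarrow> real" where
  "disc_norm n d = sqrt (\<Sum>i<n. (d i)\<^sup>2)"

lemma closed_disc_norm: "closed_disc n = {d. (\<forall>i\<ge>n. d i = 0) \<and> disc_norm n d \<le> 1}"
  by (auto simp: closed_disc_def disc_norm_def topspace_Euclidean_space)

lemma disc_boundary_norm: "disc_boundary n = {d \<in> closed_disc n. disc_norm n d = 1}"
  by (auto simp: disc_boundary_def closed_disc_def open_disc_def disc_norm_def not_less)

lemma disc_norm_nonneg [simp]: "0 \<le> disc_norm n d"
  by (simp add: disc_norm_def sum_nonneg)

lemma disc_norm_scale: "0 \<le> r \<Longrightarrow> disc_norm n (\<lambda>i. r * d i) = r * disc_norm n d"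
  by (simp add: disc_norm_def power_mult_distrib sum_distrib_left[symmetric] real_sqrt_mult)

lemma continuous_map_disc_coordinate: "continuous_map (disc_top n) euclideanreal (\<lambda>d. d i)"
  unfolding disc_top_def Euclidean_space_def
  by (intro continuous_map_from_subtopology continuous_map_product_projection) simp

lemma continuous_map_disc_norm: "continuous_map (disc_top n) euclideanreal (disc_norm n)"
  unfolding disc_norm_def
  by (intro continuous_map_compose2[OF continuous_map_square_root] continuous_intros
      continuous_map_disc_coordinate) simp

lemma continuous_map_into_disc:
  assumes "\<And>i. continuous_map X euclideanreal (\<lambda>x. f x i)" "f ` topspace X \<subseteq> closed_disc n"
  shows "continuous_map X (disc_top n) f"
  unfolding disc_top_def Euclidean_space_def
proof (intro continuous_map_into_subtopology)
  show "continuous_map X (powertop_real UNIV) f"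
    using assms(1) by (simp add: continuous_map_componentwise_UNIV)
qed (use assms(2) in \<open>auto simp: closed_disc_norm\<close>)

text \<open>The cylinder over a disc is the cone over its full boundary, with apex in the middle.\<close>

definition cylinder_gauge :: "nat \<Rightarrow> real \<times> (nat \<Rightarrow> real) \<Rightarrow> real" where
  "cylinder_gauge n p = max \<bar>2 * fst p - 1\<bar> (disc_norm n (snd p))"

definition cylinder_scale :: "real \<Rightarrow> real \<times> (nat \<Rightarrow> real) \<Rightarrow> real \<times> (nat \<Rightarrow> real)" where
  "cylinder_scale r p = (1/2 + r * (fst p - 1/2), \<lambda>i. r * snd p i)"

lemma radial_cone_cylinder:
  "radial_cone (prod_topology unit_interval (disc_top n)) (cylinder_gauge n) cylinder_scale (1/2, \<lambda>_. 0)"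
proof
  let ?B = "prod_topology unit_interval (disc_top n)"
  show "continuous_map ?B euclideanreal (cylinder_gauge n)"
    unfolding cylinder_gauge_def
    by (intro continuous_intros continuous_map_compose2[OF continuous_map_disc_norm continuous_map_snd])
  show "0 \<le> cylinder_gauge n b \<and> cylinder_gauge n b \<le> 1" if "b \<in> topspace ?B" for b
    using that by (auto simp: cylinder_gauge_def closed_disc_norm abs_le_iff le_max_iff_disj)
  have gauge: "cylinder_gauge n (cylinder_scale r p) = r * cylinder_gauge n p" if "0 \<le> r" for r p
  proof -
    have "2 * (1/2 + r * (fst p - 1/2)) - 1 = r * (2 * fst p - 1)" by (simp add: field_simps)
    then have "\<bar>2 * (1/2 + r * (fst p - 1/2)) - 1\<bar> = r * \<bar>2 * fst p - 1\<bar>"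
      using that by (simp only: abs_mult abs_of_nonneg)
    then show ?thesis
      using that unfolding cylinder_gauge_def cylinder_scale_def fst_conv snd_conv disc_norm_scale[OF that]
      by (simp only: max_mult_distrib_left if_True)
  qed
  then show "cylinder_gauge n (cylinder_scale r b) = r * cylinder_gauge n b"
    if "b \<in> topspace ?B" "0 \<le> r" "r * cylinder_gauge n b \<le> 1" for r b
    using that by simp
  show "cylinder_scale 1 b = b" for b
    by (cases b) (simp add: cylinder_scale_def)
  show "cylinder_scale 0 b = (1/2, \<lambda>_. 0)" for b
    by (simp add: cylinder_scale_def)
  show "(1/2, \<lambda>_. 0) \<in> topspace ?B"
    by (auto simp: closed_disc_norm disc_norm_def)
  let ?S = "subtopology (prod_topology euclideanreal ?B) {p. 0 \<le> fst p \<and> fst p * cylinder_gauge n (snd p) \<le> 1}"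
  have r: "continuous_map ?S euclideanreal fst"
    by (intro continuous_map_from_subtopology continuous_map_fst)
  have b: "continuous_map ?S ?B snd"
    by (intro continuous_map_from_subtopology continuous_map_snd)
  have s: "continuous_map ?S euclideanreal (\<lambda>x. fst (snd x))"
    by (rule continuous_map_compose2[OF continuous_map_fst_real b])
  have d: "continuous_map ?S (disc_top n) (\<lambda>x. snd (snd x))"
    by (rule continuous_map_compose2[OF continuous_map_snd b])
  have in_cyl: "fst p \<in> {0..1} \<and> snd p \<in> closed_disc n"
    if "cylinder_gauge n p \<le> 1" "\<And>i. i \<ge> n \<Longrightarrow> snd p i = 0" for p
    using that by (auto simp: cylinder_gauge_def closed_disc_norm abs_le_iff)
  have img: "fst (cylinder_scale (fst x) (snd x)) \<in> {0..1} \<and> snd (cylinder_scale (fst x) (snd x)) \<in> closed_disc n"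
    if x: "x \<in> topspace ?S" for x
  proof (rule in_cyl)
    show "cylinder_gauge n (cylinder_scale (fst x) (snd x)) \<le> 1"
      using x gauge by simp
    show "snd (cylinder_scale (fst x) (snd x)) i = 0" if "i \<ge> n" for i
      using x that by (auto simp: cylinder_scale_def closed_disc_norm)
  qed
  have "continuous_map ?S unit_interval (\<lambda>x. fst (cylinder_scale (fst x) (snd x)))"
    using img unfolding cylinder_scale_def fst_conv
    by (intro continuous_map_into_subtopology continuous_intros r s) auto
  moreover have "continuous_map ?S (disc_top n) (\<lambda>x. snd (cylinder_scale (fst x) (snd x)))"
  proof (rule continuous_map_into_disc)
    show "continuous_map ?S euclideanreal (\<lambda>x. snd (cylinder_scale (fst x) (snd x)) i)" for i
      unfolding cylinder_scale_def snd_conv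
      by (intro continuous_intros r continuous_map_compose2[OF continuous_map_disc_coordinate d])
  qed (use img in auto)
  ultimately show "continuous_map ?S ?B (\<lambda>p. cylinder_scale (fst p) (snd p))"
    unfolding continuous_map_pairwise by (simp add: o_def)
qed

text \<open>
  Over a disc the right translations by a family of points of a path-connected H-space form a
  family homotopic to the identity, because the disc contracts to a point and that point can be
  joined to the unit. A homotopy \<open>z\<close> from \<open>a\<close> to \<open>b\<close> is therefore constructed cell by cell, together
  with paths from \<open>\<mu> (z, c)\<close> to \<open>\<mu> (b, c)\<close> that interpolate between the given homotopy and the
  constant one: over a cell these data form a lift over the cylinder on a disc, prescribed on
  the full boundary of the cylinder.
\<close>

lemma CW_right_cancellation:
  assumes CW: "CW_complex K" and path_conn: "path_connected_space G" and H: "H_space G \<mu> e"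
    and a: "continuous_map K G a" and b: "continuous_map K G b" and c: "continuous_map K G c"
    and ac_bc: "homotopic_maps K G (\<lambda>k. \<mu> (a k, c k)) (\<lambda>k. \<mu> (b k, c k))"
  shows "homotopic_maps K G a b"
proof -
  obtain C where C: "CW_structure K C" using CW by (auto simp: CW_complex_def)
  have mu: "continuous_map (prod_topology G G) G \<mu>" and eG: "e \<in> topspace G"
    and unit: "homotopic_maps G G (\<lambda>x. \<mu> (x, e)) id"
    using H by (auto simp: H_space_def)
  define q where "q k = \<mu> (b k, c k)" for k
  have q: "continuous_map K G q"
    unfolding q_def by (intro continuous_map_compose2[OF mu] continuous_intros b c)
  obtain w where w: "continuous_map (prod_topology unit_interval K) G w"
    and w0: "\<And>k. k \<in> topspace K \<Longrightarrow> w (0, k) = \<mu> (a k, c k)"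
    and w1: "\<And>k. k \<in> topspace K \<Longrightarrow> w (1, k) = q k"
    using ac_bc unfolding homotopic_maps_iff q_def by blast
  \<comment> \<open>A lift over \<open>k\<close> is a point with a path; \<open>start\<close> and \<open>stop\<close> are the lifts at the two ends of the
    homotopy, and an admissible value over \<open>k\<close> is a path of lifts between them.\<close>
  define start where "start k = (a k, \<lambda>s\<in>{0..1::real}. w (s, k))" for k
  define stop where "stop k = (b k, \<lambda>s\<in>{0..1::real}. q k)" for k
  let ?GP = "prod_topology G (path_space G)"
  have start: "continuous_map K ?GP start"
    unfolding start_def by (intro continuous_intros a continuous_map_curry_path w)
  have stop: "continuous_map K ?GP stop"
  proof -
    have "continuous_map (prod_topology unit_interval K) G (\<lambda>p. q (snd p))"
      by (rule continuous_map_compose2[OF q continuous_map_snd])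
    from continuous_map_curry_path[OF this] show ?thesis
      unfolding stop_def by (intro continuous_map_pairedI b) simp
  qed
  define lift where "lift k v \<longleftrightarrow> snd v 0 = \<mu> (fst v, c k) \<and> snd v 1 = q k"
    for k and v :: "'b \<times> (real \<Rightarrow> 'b)"
  have lift_start: "lift k (start k)" and lift_stop: "lift k (stop k)" if "k \<in> topspace K" for k
    using that w0 w1 by (auto simp: lift_def start_def stop_def q_def)
  define Fib where "Fib k = {\<sigma> :: real \<Rightarrow> 'b \<times> (real \<Rightarrow> 'b).
      \<sigma> 0 = start k \<and> \<sigma> 1 = stop k \<and> (\<forall>s\<in>{0..1}. lift k (\<sigma> s))}" for k
  have "\<exists>s. continuous_map K (path_space ?GP) s \<and> (\<forall>k\<in>topspace K. s k \<in> Fib k)"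
  proof (rule CW_section_exists[OF C])
    fix n \<phi> \<tau>
    assume \<phi>: "continuous_map (disc_top n) K \<phi>"
      and \<tau>: "continuous_map (subtopology (disc_top n) (disc_boundary n)) (path_space ?GP) \<tau>"
      and \<tau>Fib: "\<And>d. d \<in> disc_boundary n \<Longrightarrow> \<tau> d \<in> Fib (\<phi> d)"
    let ?B = "prod_topology unit_interval (disc_top n)"
    interpret cyl: radial_cone ?B "cylinder_gauge n" cylinder_scale "(1/2, \<lambda>_. 0)"
      by (rule radial_cone_cylinder)
    let ?R = "subtopology ?B cyl.rim"
    have \<phi>K: "\<phi> d \<in> topspace K" if "d \<in> closed_disc n" for d
      using \<phi> that by (auto simp: continuous_map_def)
    have rim: "snd p \<in> disc_boundary n \<or> fst p = 0 \<or> fst p = 1" if "p \<in> topspace ?R" for p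
      using that by (auto simp: cyl.rim_def cylinder_gauge_def disc_boundary_norm max_def abs_if split: if_splits)
    have in_rim: "p \<in> cyl.rim" if "p \<in> topspace ?B" "snd p \<in> disc_boundary n \<or> fst p = 0 \<or> fst p = 1" for p
      using that by (auto simp: cyl.rim_def cylinder_gauge_def disc_boundary_norm closed_disc_norm max_def)
    \<comment> \<open>The lift on the rim: the given family on the side of the cylinder, the end lifts on bottom and top.\<close>
    define \<zeta> where "\<zeta> p = (if snd p \<in> disc_boundary n then \<tau> (snd p) (fst p)
        else if fst p = 0 then start (\<phi> (snd p)) else stop (\<phi> (snd p)))" for p :: "real \<times> (nat \<Rightarrow> real)"
    have \<zeta>0: "\<zeta> (0, d) = start (\<phi> d)" and \<zeta>1: "\<zeta> (1, d) = stop (\<phi> d)" for d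
      using \<tau>Fib[of d] by (auto simp: \<zeta>_def Fib_def)
    have Rs: "continuous_map ?R (disc_top n) snd" "continuous_map ?R unit_interval fst"
      "continuous_map ?R euclideanreal fst" "continuous_map ?R euclideanreal (\<lambda>p. disc_norm n (snd p))"
      by (intro continuous_map_from_subtopology continuous_map_snd continuous_map_fst continuous_map_fst_real
          continuous_map_compose2[OF continuous_map_disc_norm continuous_map_snd])+
    have \<zeta>: "continuous_map ?R ?GP \<zeta>"
    proof (rule pasting_lemma_closed[where I = "{0, 1, 2::nat}"
          and T = "\<lambda>i. if i = 0 then {p \<in> topspace ?R. disc_norm n (snd p) \<in> {1}}
            else if i = 1 then {p \<in> topspace ?R. fst p \<in> {0}} else {p \<in> topspace ?R. fst p \<in> {1}}"
          and f = "\<lambda>_. \<zeta>"])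
      fix i :: nat assume "i \<in> {0, 1, 2}"
      then consider "i = 0" | "i = 1" | "i = 2" by blast
      note i = this
      let ?T = "\<lambda>i::nat. if i = 0 then {p \<in> topspace ?R. disc_norm n (snd p) \<in> {1}}
            else if i = 1 then {p \<in> topspace ?R. fst p \<in> {0}} else {p \<in> topspace ?R. fst p \<in> {1}}"
      show "closedin ?R (?T i)"
        using closedin_continuous_map_preimage[OF Rs(4), of "{1}"]
          closedin_continuous_map_preimage[OF Rs(3), of "{0}"]
          closedin_continuous_map_preimage[OF Rs(3), of "{1}"] by simp
      show "continuous_map (subtopology ?R (?T i)) ?GP \<zeta>"
        using i
      proof cases
        case 1
        let ?X = "subtopology ?R (?T 0)"
        have X_bd: "continuous_map ?X (subtopology (disc_top n) (disc_boundary n)) snd"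
          by (intro continuous_map_into_subtopology continuous_map_from_subtopology[OF Rs(1)])
             (auto simp: disc_boundary_norm)
        have "continuous_map ?X ?GP (\<lambda>p. \<tau> (snd p) (fst p))"
          by (rule continuous_map_eval_path[OF continuous_map_compose2[OF \<tau> X_bd]
              continuous_map_from_subtopology[OF Rs(2)]])
        then have "continuous_map ?X ?GP \<zeta>"
        proof (rule continuous_map_eq)
          fix p assume "p \<in> topspace ?X"
          then have "snd p \<in> disc_boundary n" by (simp add: disc_boundary_norm mem_Times_iff)
          then show "\<tau> (snd p) (fst p) = \<zeta> p" by (simp add: \<zeta>_def)
        qed
        then show ?thesis using 1 by simp
      next
        case 2
        let ?X = "subtopology ?R (?T 1)"
        have "continuous_map ?X ?GP (\<lambda>p. start (\<phi> (snd p)))"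
          by (rule continuous_map_compose2[OF start continuous_map_compose2[OF \<phi>
                continuous_map_from_subtopology[OF Rs(1)]]])
        then have "continuous_map ?X ?GP \<zeta>"
        proof (rule continuous_map_eq)
          fix p assume "p \<in> topspace ?X"
          then have "p = (0, snd p)" by (simp add: prod_eq_iff)
          then show "start (\<phi> (snd p)) = \<zeta> p" using \<zeta>0[of "snd p"] by metis
        qed
        then show ?thesis using 2 by simp
      next
        case 3
        let ?X = "subtopology ?R (?T 2)"
        have "continuous_map ?X ?GP (\<lambda>p. stop (\<phi> (snd p)))"
          by (rule continuous_map_compose2[OF stop continuous_map_compose2[OF \<phi>
                continuous_map_from_subtopology[OF Rs(1)]]])
        then have "continuous_map ?X ?GP \<zeta>"
        proof (rule continuous_map_eq)
          fix p assume "p \<in> topspace ?X"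
          then have "p = (1, snd p)" by (simp add: prod_eq_iff)
          then show "stop (\<phi> (snd p)) = \<zeta> p" using \<zeta>1[of "snd p"] by metis
        qed
        then show ?thesis using 3 by simp
      qed
    next
      fix p assume p: "p \<in> topspace ?R"
      then consider "disc_norm n (snd p) = 1" | "fst p = 0" | "fst p = 1"
        using rim[OF p] by (auto simp: disc_boundary_norm)
      then show "\<exists>j. j \<in> {0, 1, 2::nat} \<and> p \<in> (if j = 0 then {p \<in> topspace ?R. disc_norm n (snd p) \<in> {1}}
            else if j = 1 then {p \<in> topspace ?R. fst p \<in> {0}} else {p \<in> topspace ?R. fst p \<in> {1}}) \<and> \<zeta> p = \<zeta> p"
      proof cases
        case 1 then show ?thesis using p by (intro exI[of _ 0]) simp
      next
        case 2 then show ?thesis using p by (intro exI[of _ 1]) simp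
      next
        case 3 then show ?thesis using p by (intro exI[of _ 2]) simp
      qed
    qed auto
    have \<zeta>lift: "lift (\<phi> (snd p)) (\<zeta> p)" if p: "p \<in> topspace ?B" "p \<in> cyl.rim" for p
    proof -
      have d: "snd p \<in> closed_disc n" and s: "fst p \<in> {0..1}" using p(1) by auto
      show ?thesis
      proof (cases "snd p \<in> disc_boundary n")
        case True
        then show ?thesis using \<tau>Fib[OF True] s by (simp add: \<zeta>_def Fib_def)
      next
        case False
        then show ?thesis
          using rim[of p] p lift_start[OF \<phi>K[OF d]] lift_stop[OF \<phi>K[OF d]] by (auto simp: \<zeta>_def)
      qed
    qed
    have c\<phi>: "continuous_map ?B G (\<lambda>p. c (\<phi> (snd p)))" and q\<phi>: "continuous_map ?B G (\<lambda>p. q (\<phi> (snd p)))"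
      by (intro continuous_map_compose2[OF c] continuous_map_compose2[OF q]
          continuous_map_compose2[OF \<phi> continuous_map_snd])+
    have r: "homotopic_maps (prod_topology ?B G) G (\<lambda>v. \<mu> (snd v, c (\<phi> (snd (fst v))))) snd"
    proof -
      have "c (\<phi> (snd (1/2::real, \<lambda>_. 0))) \<in> topspace G"
        using c\<phi> cyl.apex unfolding continuous_map_def by blast
      then have "homotopic_maps ?B G (\<lambda>p. c (\<phi> (snd p))) (\<lambda>_. e)"
        by (rule homotopic_with_trans[OF cyl.homotopic_maps_apex[OF c\<phi>] homotopic_maps_const[OF path_conn _ eG]])
      then have "homotopic_maps (prod_topology ?B G) G (\<lambda>v. c (\<phi> (snd (fst v)))) (\<lambda>_. e)"
        by (rule homotopic_maps_compose_right[OF _ continuous_map_fst])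
      then have "homotopic_maps (prod_topology ?B G) G (\<lambda>v. \<mu> (snd v, c (\<phi> (snd (fst v))))) (\<lambda>v. \<mu> (snd v, e))"
        by (intro homotopic_maps_compose_left[OF _ mu] homotopic_maps_pair) (auto intro: continuous_intros)
      moreover have "homotopic_maps (prod_topology ?B G) G (\<lambda>v. \<mu> (snd v, e)) snd"
        using homotopic_maps_compose_right[OF unit continuous_map_snd] by simp
      ultimately show ?thesis by (rule homotopic_with_trans)
    qed
    have z: "continuous_map ?R G (\<lambda>p. fst (\<zeta> p))"
      by (rule continuous_map_compose2[OF continuous_map_fst \<zeta>])
    have \<omega>: "continuous_map (prod_topology unit_interval ?R) G (\<lambda>v. snd (\<zeta> (snd v)) (fst v))"
      using continuous_map_compose2[OF continuous_map_snd \<zeta>] unfolding continuous_map_path_space_iff by blast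
    obtain z' \<omega>' where z': "continuous_map ?B G z'" and \<omega>': "continuous_map (prod_topology unit_interval ?B) G \<omega>'"
      and \<omega>'0: "\<And>p. p \<in> topspace ?B \<Longrightarrow> \<omega>' (0, p) = \<mu> (z' p, c (\<phi> (snd p)))"
      and \<omega>'1: "\<And>p. p \<in> topspace ?B \<Longrightarrow> \<omega>' (1, p) = q (\<phi> (snd p))"
      and z'_rim: "\<And>p. p \<in> topspace ?B \<Longrightarrow> p \<in> cyl.rim \<Longrightarrow> z' p = fst (\<zeta> p)"
      and \<omega>'_rim: "\<And>p s. p \<in> topspace ?B \<Longrightarrow> p \<in> cyl.rim \<Longrightarrow> s \<in> {0..1} \<Longrightarrow> \<omega>' (s, p) = snd (\<zeta> p) s"
    proof (rule cyl.lift_extension[OF q\<phi> r z \<omega>])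
      show "snd (\<zeta> (snd (0, p))) (fst (0::real, p)) = \<mu> (snd (p, fst (\<zeta> p)), c (\<phi> (snd (fst (p, fst (\<zeta> p))))))"
        "snd (\<zeta> (snd (1, p))) (fst (1::real, p)) = q (\<phi> (snd p))"
        if "p \<in> topspace ?B" "p \<in> cyl.rim" for p
        using \<zeta>lift[OF that] by (simp_all add: lift_def)
    qed (simp only: fst_conv snd_conv)
    define H where "H p = (z' p, \<lambda>s\<in>{0..1}. \<omega>' (s, p))" for p
    have H: "continuous_map ?B ?GP H"
      unfolding H_def by (intro continuous_intros z' continuous_map_curry_path \<omega>')
    have H_rim: "H p = \<zeta> p" if p: "p \<in> topspace ?B" "p \<in> cyl.rim" for p
    proof -
      have "\<zeta> p \<in> topspace ?GP" using \<zeta> p by (auto simp: continuous_map_def)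
      then have "snd (\<zeta> p) \<in> extensional {0..1}" by (auto simp: topspace_path_space)
      then have "(\<lambda>s\<in>{0..1}. \<omega>' (s, p)) = snd (\<zeta> p)"
        using \<omega>'_rim[OF p] by (auto simp: fun_eq_iff extensional_def)
      then show ?thesis using z'_rim[OF p] by (simp add: H_def prod_eq_iff)
    qed
    define \<tau>' where "\<tau>' d = (\<lambda>s\<in>{0..1}. H (s, d))" for d
    have "continuous_map (disc_top n) (path_space ?GP) \<tau>'"
      unfolding \<tau>'_def by (rule continuous_map_curry_path[OF H])
    moreover have "\<tau>' d \<in> Fib (\<phi> d)" if d: "d \<in> closed_disc n" for d
    proof -
      have B: "(s, d) \<in> topspace ?B" if "s \<in> {0..1}" for s using that d by simp
      have "lift (\<phi> d) (H (s, d))" if "s \<in> {0..1}" for s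
        using \<omega>'0[OF B[OF that]] \<omega>'1[OF B[OF that]] by (simp add: lift_def H_def)
      moreover have "H (0, d) = start (\<phi> d)" "H (1, d) = stop (\<phi> d)"
        using H_rim[OF B in_rim[OF B]] \<zeta>0 \<zeta>1 by auto
      ultimately show ?thesis by (simp add: Fib_def \<tau>'_def)
    qed
    moreover have "\<tau>' d = \<tau> d" if d: "d \<in> disc_boundary n" for d
    proof -
      have dc: "d \<in> closed_disc n" using d by (simp add: disc_boundary_def)
      then have "d \<in> topspace (subtopology (disc_top n) (disc_boundary n))" using d by simp
      then have "\<tau> d \<in> topspace (path_space ?GP)" using \<tau> by (auto simp: continuous_map_def)
      then have ex: "\<tau> d \<in> extensional {0..1}" by (simp add: topspace_path_space)
      have "H (s, d) = \<tau> d s" if s: "s \<in> {0..1}" for s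
        using H_rim[of "(s, d)"] in_rim[of "(s, d)"] d dc s by (simp add: \<zeta>_def)
      then show ?thesis
        using ex by (auto simp: \<tau>'_def fun_eq_iff extensional_def)
    qed
    ultimately show "\<exists>\<tau>'. continuous_map (disc_top n) (path_space ?GP) \<tau>' \<and>
        (\<forall>d\<in>closed_disc n. \<tau>' d \<in> Fib (\<phi> d)) \<and> (\<forall>d\<in>disc_boundary n. \<tau>' d = \<tau> d)"
      by blast
  qed
  then obtain s where s: "continuous_map K (path_space ?GP) s" "\<And>k. k \<in> topspace K \<Longrightarrow> s k \<in> Fib k"
    by blast
  have "continuous_map (prod_topology unit_interval K) ?GP (\<lambda>p. s (snd p) (fst p))"
    using s(1) unfolding continuous_map_path_space_iff by blast
  then have "continuous_map (prod_topology unit_interval K) G (\<lambda>p. fst (s (snd p) (fst p)))"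
    by (rule continuous_map_compose2[OF continuous_map_fst])
  moreover have "fst (s k 0) = a k \<and> fst (s k 1) = b k" if "k \<in> topspace K" for k
    using s(2)[OF that] by (simp add: Fib_def start_def stop_def)
  ultimately show ?thesis
    unfolding homotopic_maps_iff by (intro exI[of _ "\<lambda>p. fst (s (snd p) (fst p))"]) auto
qed

section \<open>Homotopy of maps and the difference map\<close>

text \<open>
  The two properties by which \<open>F\<close> acts as a difference: adding the subtrahend to a difference
  gives back the minuend, and the difference of equal arguments is null, both up to homotopy.
  Group-like spaces and path-connected CW H-spaces both have them.
\<close>

locale homotopy_difference =
  fixes G :: "'g topology" and \<mu> F :: "'g \<times> 'g \<Rightarrow> 'g" and e :: 'g
  assumes H_space: "H_space G \<mu> e"
    and continuous_difference: "continuous_map (prod_topology G G) G F"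
    and add_difference: "homotopic_maps (prod_topology G G) G (\<lambda>z. \<mu> (F z, snd z)) fst"
    and difference_self: "homotopic_maps G G (\<lambda>x. F (x, x)) (\<lambda>_. e)"
begin

text \<open>
  If \<open>a\<close> is homotopic to \<open>b\<close>, then \<open>F (a, b)\<close> is homotopic to \<open>F (b, b)\<close>, which is null; if
  \<open>F (a, b)\<close> is null, then \<open>a\<close> is homotopic to \<open>\<mu> (F (a, b), b)\<close> and hence to \<open>\<mu> (e, b)\<close>.
\<close>

lemma homotopic_iff_null_difference:
  assumes a: "continuous_map U G a" and b: "continuous_map U G b"
  shows "homotopic_maps U G a b \<longleftrightarrow> homotopic_maps U G (\<lambda>u. F (a u, b u)) (\<lambda>_. e)"
proof
  assume ab: "homotopic_maps U G a b"
  have "homotopic_maps U G (\<lambda>u. F (a u, b u)) (\<lambda>u. F (b u, b u))"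
    by (rule homotopic_maps_compose_left[OF homotopic_maps_pair[OF ab] continuous_difference])
       (simp add: b)
  then show "homotopic_maps U G (\<lambda>u. F (a u, b u)) (\<lambda>_. e)"
    using homotopic_maps_compose_right[OF difference_self b] by (rule homotopic_with_trans)
next
  assume null: "homotopic_maps U G (\<lambda>u. F (a u, b u)) (\<lambda>_. e)"
  have mu: "continuous_map (prod_topology G G) G \<mu>" and unit: "homotopic_maps G G (\<lambda>x. \<mu> (e, x)) id"
    using H_space by (auto simp: H_space_def)
  have "continuous_map U (prod_topology G G) (\<lambda>u. (a u, b u))"
    by (intro continuous_intros a b)
  from homotopic_maps_compose_right[OF add_difference this]
  have "homotopic_maps U G a (\<lambda>u. \<mu> (F (a u, b u), b u))"
    by (simp add: homotopic_with_sym)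
  also have "homotopic_maps U G (\<lambda>u. \<mu> (F (a u, b u), b u)) (\<lambda>u. \<mu> (e, b u))"
    by (rule homotopic_maps_compose_left[OF homotopic_maps_pair[OF null] mu]) (simp add: b)
  also (homotopic_with_trans) have "homotopic_maps U G (\<lambda>u. \<mu> (e, b u)) b"
    using homotopic_maps_compose_right[OF unit b] by simp
  finally (homotopic_with_trans) show "homotopic_maps U G a b" .
qed

lemma homotopic_chain_iff_null_diff_map:
  assumes f: "\<forall>i\<in>{1..m}. continuous_map U G (f i)"
  shows "(\<forall>i\<in>{1..<m}. homotopic_maps U G (f i) (f (Suc i))) \<longleftrightarrow>
    homotopic_maps U (power_top G (m - 1)) (diff_map m F \<circ> tuple_map m f) (\<lambda>_. \<lambda>i\<in>{1..m-1}. e)"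
    (is "?L \<longleftrightarrow> ?R")
proof -
  have 1: "{1..<m} = {1..m-1}" by auto
  have eq: "(diff_map m F \<circ> tuple_map m f) u = (\<lambda>i\<in>{1..m-1}. F (f i u, f (Suc i) u))" for u
    by (auto simp: diff_map_def tuple_map_def fun_eq_iff)
  have "?L \<longleftrightarrow> (\<forall>i\<in>{1..m-1}. homotopic_maps U G (\<lambda>u. F (f i u, f (Suc i) u)) (\<lambda>_. e))"
    unfolding 1 using f by (intro ball_cong homotopic_iff_null_difference refl) auto
  also have "\<dots> \<longleftrightarrow> ?R"
  proof
    assume "\<forall>i\<in>{1..m-1}. homotopic_maps U G (\<lambda>u. F (f i u, f (Suc i) u)) (\<lambda>_. e)"
    then obtain h where h: "\<And>i. i \<in> {1..m-1} \<Longrightarrow> continuous_map (prod_topology unit_interval U) G (h i)"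
      "\<And>i u. i \<in> {1..m-1} \<Longrightarrow> u \<in> topspace U \<Longrightarrow> h i (0, u) = F (f i u, f (Suc i) u) \<and> h i (1, u) = e"
      unfolding homotopic_maps_iff by metis
    show ?R
      unfolding homotopic_maps_iff
    proof (intro exI[of _ "\<lambda>z. \<lambda>i\<in>{1..m-1}. h i z"] conjI ballI)
      show "continuous_map (prod_topology unit_interval U) (power_top G (m - 1)) (\<lambda>z. \<lambda>i\<in>{1..m-1}. h i z)"
        unfolding continuous_map_componentwise using h(1) by (auto simp: image_subset_iff)
      fix u assume u: "u \<in> topspace U"
      show "(\<lambda>i\<in>{1..m-1}. h i (0, u)) = (diff_map m F \<circ> tuple_map m f) u"
        "(\<lambda>i\<in>{1..m-1}. h i (1, u)) = (\<lambda>i\<in>{1..m-1}. e)"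
        unfolding eq using h(2)[OF _ u] by (auto simp: fun_eq_iff)
    qed
  next
    assume R: ?R
    show "\<forall>i\<in>{1..m-1}. homotopic_maps U G (\<lambda>u. F (f i u, f (Suc i) u)) (\<lambda>_. e)"
    proof
      fix i assume i: "i \<in> {1..m-1}"
      have "continuous_map (power_top G (m - 1)) G (\<lambda>x. x i)"
        using i by (intro continuous_map_product_projection)
      from homotopic_maps_compose_left[OF R this]
      show "homotopic_maps U G (\<lambda>u. F (f i u, f (Suc i) u)) (\<lambda>_. e)"
        using i unfolding eq by simp
    qed
  qed
  finally show ?thesis .
qed

end

lemma homotopic_pairs_iff_chain:
  assumes f: "\<forall>i\<in>{1..m::nat}. continuous_map U G (f i)"
  shows "(\<forall>i\<in>{1..m}. \<forall>j\<in>{1..m}. homotopic_maps U G (f i) (f j)) \<longleftrightarrow>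
         (\<forall>i\<in>{1..<m}. homotopic_maps U G (f i) (f (Suc i)))"
proof (intro iffI ballI)
  fix i j assume chain: "\<forall>i\<in>{1..<m}. homotopic_maps U G (f i) (f (Suc i))" and ij: "i \<in> {1..m}" "j \<in> {1..m}"
  have 1: "homotopic_maps U G (f 1) (f k)" if "1 \<le> k" "k \<le> m" for k
    using that
  proof (induction k rule: nat_induct_at_least)
    case base
    then show ?case using f by simp
  next
    case (Suc k)
    then have "homotopic_maps U G (f k) (f (Suc k))" using chain by auto
    then show ?case using Suc by (meson Suc_leD homotopic_with_trans)
  qed
  show "homotopic_maps U G (f i) (f j)"
    using 1[of i] 1[of j] ij by (meson atLeastAtMost_iff homotopic_with_symD homotopic_with_trans)
qed auto

lemma homotopy_difference_group_like:
  assumes "group_like_space G \<mu> e \<eta>"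
  shows "homotopy_difference G \<mu> (\<mu> \<circ> map_prod id \<eta>) e"
proof
  have H: "H_space G \<mu> e" and \<eta>: "continuous_map G G \<eta>"
    and assoc: "homotopic_maps (prod_topology G (prod_topology G G)) G
       (\<lambda>(x, y, z). \<mu> (\<mu> (x, y), z)) (\<lambda>(x, y, z). \<mu> (x, \<mu> (y, z)))"
    and right_inv: "homotopic_maps G G (\<lambda>x. \<mu> (x, \<eta> x)) (\<lambda>_. e)"
    and left_inv: "homotopic_maps G G (\<lambda>x. \<mu> (\<eta> x, x)) (\<lambda>_. e)"
    using assms by (auto simp: group_like_space_def)
  have mu: "continuous_map (prod_topology G G) G \<mu>" and unit: "homotopic_maps G G (\<lambda>x. \<mu> (x, e)) id"
    using H by (auto simp: H_space_def)
  let ?P = "prod_topology G G"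
  have \<eta>2: "continuous_map ?P G (\<lambda>z. \<eta> (snd z))"
    by (rule continuous_map_compose2[OF \<eta> continuous_map_snd])
  show "H_space G \<mu> e" by (rule H)
  show "continuous_map ?P G (\<mu> \<circ> map_prod id \<eta>)"
    by (rule continuous_map_eq[OF continuous_map_compose2[OF mu continuous_map_pairedI[OF continuous_map_fst \<eta>2]]])
       (auto simp: map_prod_def split_beta)
  show "homotopic_maps G G (\<lambda>x. (\<mu> \<circ> map_prod id \<eta>) (x, x)) (\<lambda>_. e)"
    using right_inv by simp
  have "continuous_map ?P (prod_topology G ?P) (\<lambda>z. (fst z, \<eta> (snd z), snd z))"
    by (intro continuous_map_pairedI continuous_map_fst \<eta>2 continuous_map_snd)
  from homotopic_maps_compose_right[OF assoc this]
  have "homotopic_maps ?P G (\<lambda>z. \<mu> (\<mu> (fst z, \<eta> (snd z)), snd z)) (\<lambda>z. \<mu> (fst z, \<mu> (\<eta> (snd z), snd z)))"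
    by simp
  also have "homotopic_maps ?P G (\<lambda>z. \<mu> (fst z, \<mu> (\<eta> (snd z), snd z))) (\<lambda>z. \<mu> (fst z, e))"
    using homotopic_maps_compose_right[OF left_inv continuous_map_snd]
    by (intro homotopic_maps_compose_left[OF homotopic_maps_pair mu]) (auto intro: continuous_map_fst)
  also (homotopic_with_trans) have "homotopic_maps ?P G (\<lambda>z. \<mu> (fst z, e)) fst"
    using homotopic_maps_compose_right[OF unit continuous_map_fst] by simp
  finally (homotopic_with_trans) show "homotopic_maps ?P G (\<lambda>z. \<mu> ((\<mu> \<circ> map_prod id \<eta>) z, snd z)) fst"
    by (simp add: map_prod_def split_beta)
qed

text \<open>
  On the diagonal \<open>\<mu> (F (x, x), x)\<close> and \<open>\<mu> (e, x)\<close> are both homotopic to \<open>x\<close>, so that the nullity of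
  \<open>F (x, x)\<close> is an instance of right cancellation.
\<close>

lemma homotopy_difference_CW:
  assumes "path_connected_space G" "CW_complex G" "H_space G \<mu> e" "James_difference G \<mu> F"
  shows "homotopy_difference G \<mu> F e"
proof
  show H: "H_space G \<mu> e" by fact
  show F: "continuous_map (prod_topology G G) G F"
    and add: "homotopic_maps (prod_topology G G) G (\<lambda>z. \<mu> (F z, snd z)) fst"
    using assms(4) by (auto simp: James_difference_def)
  have diag: "continuous_map G (prod_topology G G) (\<lambda>x. (x, x))"
    by (intro continuous_map_pairedI) auto
  show "homotopic_maps G G (\<lambda>x. F (x, x)) (\<lambda>_. e)"
  proof (rule CW_right_cancellation[OF assms(2,1) H])
    show "continuous_map G G (\<lambda>x. F (x, x))"
      by (rule continuous_map_compose2[OF F diag])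
    have "homotopic_maps G G (\<lambda>x. \<mu> (F (x, x), x)) (\<lambda>x. x)"
      using homotopic_maps_compose_right[OF add diag] by simp
    moreover have "homotopic_maps G G (\<lambda>x. \<mu> (e, x)) (\<lambda>x. x)"
      using H by (simp add: H_space_def id_def)
    ultimately show "homotopic_maps G G (\<lambda>x. \<mu> (F (x, x), x)) (\<lambda>x. \<mu> (e, x))"
      by (meson homotopic_with_symD homotopic_with_trans)
  qed (use H in \<open>auto simp: H_space_def\<close>)
qed

section \<open>The two path fibrations\<close>

text \<open>
  By the exponential law, a lift of \<open>k\<close> to either total space is a homotopy, respectively a
  chain of homotopies.
\<close>

lemma section_cat_space_iff:
  assumes k: "continuous_map U X k"
  shows "(\<exists>s. continuous_map U (cat_space X Y y0 g) s \<and> (\<forall>u\<in>topspace U. fst (s u) = k u)) \<longleftrightarrow>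
         homotopic_maps U Y (\<lambda>u. g (k u)) (\<lambda>_. y0)"
proof
  assume "\<exists>s. continuous_map U (cat_space X Y y0 g) s \<and> (\<forall>u\<in>topspace U. fst (s u) = k u)"
  then obtain s where s: "continuous_map U (cat_space X Y y0 g) s" "\<And>u. u \<in> topspace U \<Longrightarrow> fst (s u) = k u"
    by blast
  have "continuous_map U (prod_topology X (based_path_space Y y0)) s"
    and v: "\<And>u. u \<in> topspace U \<Longrightarrow> g (fst (s u)) = snd (s u) 0"
    using s(1) by (auto simp: cat_space_def pullback_space_def continuous_map_in_subtopology Pi_iff split_beta)
  then have "continuous_map U (based_path_space Y y0) (\<lambda>u. snd (s u))"
    using continuous_map_compose2[OF continuous_map_snd] by blast
  then have p: "continuous_map U (path_space Y) (\<lambda>u. snd (s u))"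
    and e: "\<And>u. u \<in> topspace U \<Longrightarrow> snd (s u) 1 = y0"
    by (auto simp: based_path_space_def continuous_map_in_subtopology Pi_iff)
  show "homotopic_maps U Y (\<lambda>u. g (k u)) (\<lambda>_. y0)"
    unfolding homotopic_maps_iff
  proof (intro exI conjI ballI)
    show "continuous_map (prod_topology unit_interval U) Y (\<lambda>z. snd (s (snd z)) (fst z))"
      using p unfolding continuous_map_path_space_iff by blast
  qed (use v e s(2) in auto)
next
  assume "homotopic_maps U Y (\<lambda>u. g (k u)) (\<lambda>_. y0)"
  then obtain h where h: "continuous_map (prod_topology unit_interval U) Y h"
    "\<And>u. u \<in> topspace U \<Longrightarrow> h (0, u) = g (k u) \<and> h (1, u) = y0"
    unfolding homotopic_maps_iff by blast
  let ?s = "\<lambda>u. (k u, \<lambda>r\<in>{0..1::real}. h (r, u))"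
  have "continuous_map U (cat_space X Y y0 g) ?s"
    unfolding cat_space_def pullback_space_def based_path_space_def
    by (intro continuous_map_into_subtopology continuous_map_pairedI k continuous_map_curry_path h(1))
       (use h(2) in auto)
  then show "\<exists>s. continuous_map U (cat_space X Y y0 g) s \<and> (\<forall>u\<in>topspace U. fst (s u) = k u)"
    by (intro exI[of _ ?s]) auto
qed

lemma section_hdist_space_iff:
  assumes t: "m \<ge> 1" "t 1 = 0" "t m = 1" "strict_mono_on {1..m} t"
    and f: "\<forall>i\<in>{1..m}. continuous_map X G (f i)" and k: "continuous_map U X k"
  shows "(\<exists>s. continuous_map U (hdist_space X G m t f) s \<and> (\<forall>u\<in>topspace U. fst (s u) = k u)) \<longleftrightarrow>
         (\<forall>i\<in>{1..<m}. homotopic_maps U G (\<lambda>u. f i (k u)) (\<lambda>u. f (Suc i) (k u)))"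
proof -
  have fk: "continuous_map U G (\<lambda>u. f i (k u))" if "i \<in> {1..m}" for i
    by (rule continuous_map_compose2[OF bspec[OF f that] k])
  have ev: "tuple_map m f x = path_eval m t \<gamma> \<longleftrightarrow> (\<forall>i\<in>{1..m}. \<gamma> (t i) = f i x)" for x \<gamma>
    by (auto simp: tuple_map_def path_eval_def fun_eq_iff restrict_def)
  have "(\<exists>s. continuous_map U (hdist_space X G m t f) s \<and> (\<forall>u\<in>topspace U. fst (s u) = k u)) \<longleftrightarrow>
      (\<exists>h. continuous_map U (path_space G) h \<and> (\<forall>u\<in>topspace U. \<forall>i\<in>{1..m}. h u (t i) = f i (k u)))"
  proof
    assume "\<exists>s. continuous_map U (hdist_space X G m t f) s \<and> (\<forall>u\<in>topspace U. fst (s u) = k u)"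
    then obtain s where s: "continuous_map U (hdist_space X G m t f) s" "\<And>u. u \<in> topspace U \<Longrightarrow> fst (s u) = k u"
      by blast
    have "continuous_map U (prod_topology X (path_space G)) s"
      and "\<And>u. u \<in> topspace U \<Longrightarrow> tuple_map m f (fst (s u)) = path_eval m t (snd (s u))"
      using s(1) by (auto simp: hdist_space_def pullback_space_def continuous_map_in_subtopology Pi_iff split_beta)
    then show "\<exists>h. continuous_map U (path_space G) h \<and> (\<forall>u\<in>topspace U. \<forall>i\<in>{1..m}. h u (t i) = f i (k u))"
      using continuous_map_compose2[OF continuous_map_snd] s(2) unfolding ev
      by (intro exI[of _ "\<lambda>u. snd (s u)"]) auto
  next
    assume "\<exists>h. continuous_map U (path_space G) h \<and> (\<forall>u\<in>topspace U. \<forall>i\<in>{1..m}. h u (t i) = f i (k u))"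
    then obtain h where h: "continuous_map U (path_space G) h"
      "\<And>u i. u \<in> topspace U \<Longrightarrow> i \<in> {1..m} \<Longrightarrow> h u (t i) = f i (k u)" by blast
    have "continuous_map U (hdist_space X G m t f) (\<lambda>u. (k u, h u))"
      unfolding hdist_space_def pullback_space_def
      by (intro continuous_map_into_subtopology continuous_map_pairedI k h(1)) (auto simp: ev h(2))
    then show "\<exists>s. continuous_map U (hdist_space X G m t f) s \<and> (\<forall>u\<in>topspace U. fst (s u) = k u)"
      by (intro exI[of _ "\<lambda>u. (k u, h u)"]) auto
  qed
  also have "\<dots> \<longleftrightarrow> (\<forall>i\<in>{1..<m}. homotopic_maps U G (\<lambda>u. f i (k u)) (\<lambda>u. f (Suc i) (k u)))"
    by (rule homotopic_iff_path_family[OF t fk, symmetric])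
  finally show ?thesis .
qed

context homotopy_difference
begin

text \<open>
  Over any map \<open>k\<close> into \<open>X\<close>, the two path fibrations have sections under the same condition. For
  inclusions of open sets this compares the covers; for the projections of the total spaces it
  provides maps over \<open>X\<close> in both directions.
\<close>

lemma section_hdist_iff_section_cat:
  assumes t: "m \<ge> 1" "t 1 = 0" "t m = 1" "strict_mono_on {1..m} t"
    and f: "\<forall>i\<in>{1..m}. continuous_map X G (f i)" and k: "continuous_map U X k"
  shows "(\<exists>s. continuous_map U (hdist_space X G m t f) s \<and> (\<forall>u\<in>topspace U. fst (s u) = k u)) \<longleftrightarrow>
    (\<exists>s. continuous_map U (cat_space X (power_top G (m - 1)) (\<lambda>i\<in>{1..m-1}. e) (diff_map m F \<circ> tuple_map m f)) s \<and>
      (\<forall>u\<in>topspace U. fst (s u) = k u))"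
proof -
  have fk: "\<forall>i\<in>{1..m}. continuous_map U G (\<lambda>u. f i (k u))"
    using f continuous_map_compose2[OF _ k] by blast
  have "diff_map m F \<circ> tuple_map m (\<lambda>i u. f i (k u)) = (\<lambda>u. (diff_map m F \<circ> tuple_map m f) (k u))"
    by (simp add: fun_eq_iff tuple_map_def)
  with homotopic_chain_iff_null_diff_map[OF fk] show ?thesis
    unfolding section_hdist_space_iff[OF t f k] section_cat_space_iff[OF k] by simp
qed

end

theorem theorem7p2:
  fixes G :: "'g topology" and \<mu> F :: "'g \<times> 'g \<Rightarrow> 'g" and e :: 'g
    and X :: "'x topology" and f :: "nat \<Rightarrow> 'x \<Rightarrow> 'g"
    and m :: nat and t :: "nat \<Rightarrow> real"
  assumes "path_connected_space G"
    and "(\<exists>\<eta>. group_like_space G \<mu> e \<eta> \<and> F = \<mu> \<circ> map_prod id \<eta>) \<or>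
         (CW_complex G \<and> H_space G \<mu> e \<and> James_difference G \<mu> F)"
    and "m \<ge> 2"
    and "\<And>i. i \<in> {1..m} \<Longrightarrow> continuous_map X G (f i)"
    and "t 1 = 0" and "t m = 1" and "strict_mono_on {1..m} t"
  defines "e' \<equiv> (\<lambda>i\<in>{1..m-1}. e)"
    and "g \<equiv> diff_map m F \<circ> tuple_map m f"
  shows "hdist X G m f = cat X (power_top G (m - 1)) e' g \<and>
         dhdist X G m t f = dcat X (power_top G (m - 1)) e' g \<and>
         (\<forall>M M'. mtopology_of M = hdist_space X G m t f \<and>
                 mtopology_of M' = cat_space X (power_top G (m - 1)) e' g \<longrightarrow>
            dsecat_LP M X fst = dsecat_LP M' X fst)"
proof -
  have m: "m \<ge> 1" using assms(3) by simp
  interpret homotopy_difference G \<mu> F e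
    using assms(2)
  proof (elim disjE exE conjE)
    show "homotopy_difference G \<mu> F e" if "group_like_space G \<mu> e \<eta>" "F = \<mu> \<circ> map_prod id \<eta>" for \<eta>
      unfolding that(2) using that(1) by (rule homotopy_difference_group_like)
  qed (rule homotopy_difference_CW[OF assms(1)])
  let ?P = "hdist_space X G m t f" and ?Q = "cat_space X (power_top G (m - 1)) e' g"
  have f: "\<forall>i\<in>{1..m}. continuous_map X G (f i)" using assms(4) by blast
  note sections = section_hdist_iff_section_cat[OF m assms(5-7) f, folded e'_def g_def]
  have "(\<forall>i\<in>{1..m}. \<forall>i'\<in>{1..m}. homotopic_maps (subtopology X V) G (f i) (f i')) \<longleftrightarrow>
      (\<exists>s. continuous_map (subtopology X V) ?Q s \<and> (\<forall>b\<in>V. fst (s b) = b))"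
    if V: "openin X V" for V
  proof -
    have V': "topspace (subtopology X V) = V" using openin_subset[OF V] by auto
    have k: "continuous_map (subtopology X V) X (\<lambda>x. x)" by (simp add: continuous_map_from_subtopology)
    show ?thesis
      using sections[OF k, unfolded V'] section_hdist_space_iff[OF m assms(5-7) f k, unfolded V']
        homotopic_pairs_iff_chain[of m "subtopology X V" G f]
      by (simp add: f continuous_map_from_subtopology)
  qed
  then have 1: "hdist X G m f = cat X (power_top G (m - 1)) e' g"
    unfolding hdist_def cat_def secat_def by (intro arg_cong[of _ _ Inf]) (simp cong: conj_cong)
  have "continuous_map ?P X fst" "continuous_map ?Q X fst"
    unfolding hdist_space_def cat_space_def pullback_space_def
    by (intro continuous_map_from_subtopology continuous_map_fst)+
  note proj = this
  have idP: "\<exists>s. continuous_map ?P ?P s \<and> (\<forall>u\<in>topspace ?P. fst (s u) = fst u)"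
    by (intro exI[of _ "\<lambda>u. u"]) simp
  have idQ: "\<exists>s. continuous_map ?Q ?Q s \<and> (\<forall>u\<in>topspace ?Q. fst (s u) = fst u)"
    by (intro exI[of _ "\<lambda>u. u"]) simp
  \<comment> \<open>The identity lifts the projection of each total space to that space itself, so the projection lifts to the other one as well.\<close>
  obtain \<alpha> where \<alpha>: "continuous_map ?P ?Q \<alpha>" "\<And>u. u \<in> topspace ?P \<Longrightarrow> fst (\<alpha> u) = fst u"
    using idP unfolding sections[OF proj(1)] by blast
  obtain \<beta> where \<beta>: "continuous_map ?Q ?P \<beta>" "\<And>u. u \<in> topspace ?Q \<Longrightarrow> fst (\<beta> u) = fst u"
    using idQ unfolding sections[OF proj(2), symmetric] by blast
  have 2: "dhdist X G m t f = dcat X (power_top G (m - 1)) e' g"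
    unfolding dhdist_def dcat_def
    using dsecat_mono[OF \<alpha>(1), of fst fst X] dsecat_mono[OF \<beta>(1), of fst fst X] \<alpha>(2) \<beta>(2)
    by (simp add: order_antisym)
  have 3: "dsecat_LP M X fst = dsecat_LP M' X fst" if "mtopology_of M = ?P" "mtopology_of M' = ?Q" for M M'
    using dsecat_LP_mono[of M M' \<alpha> fst fst X] dsecat_LP_mono[of M' M \<beta> fst fst X] \<alpha> \<beta>
    unfolding that by (simp add: order_antisym)
  show ?thesis using 1 2 3 by blast
qed

end
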